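(* Let $P(w,z)\in\mathbb{C}[w,z]$ be an irreducible polynomial of positive degree in $w$, let $X$ be the compact Riemann surface of the algebraic curve $P(w,z)=0$, and let $z:X\to\overline{\mathbb{C}}$ be the meromorphic function on $X$ given by the coordinate $z$. Let $S\subset X$ be the complement of the (finite) set consisting of the poles of $z$ and of the ramification points of $z$. Then $S$ carries a log-Riemann surface structure, defined using only infinite straight cuts, whose projection mapping is $z|_S$.
   Context: A straight cut is a closed Euclidean half-line in $\mathbb{C}$; its base point is its finite endpoint. A log-Riemann surface is a connected Riemann surface $S$ equipped with an atlas of charts $\varphi_i:U_i\to\mathbb{C}$ such that: (a) $\varphi_i$ is a biholomorphism of $U_i$ onto $\mathbb{C}-\Gamma_i$, where $\Gamma_i$ is a (possibly empty) locally finite union of disjoint straight cuts whose base points form a discrete set; (b) at every point of a cut of $\Gamma_i$ other than its base point, $\varphi_i^{-1}$ extends from each of the two sides of the cut to a local holomorphic diffeomorphism into $S$, and the two extensions do not coincide; (c) all changes of charts $\varphi_i\circ\varphi_j^{-1}$ are the identity. By (c) the charts define a global local biholomorphism $\pi:S\to\mathbb{C}$ with $\pi|_{U_i}=\varphi_i$, the projection mapping. *)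

theory Defs
  imports
    "HOL-Complex_Analysis.Complex_Analysis"
    "HOL-Computational_Algebra.Computational_Algebra"
begin

section \<open>Riemann surfaces\<close>

type_synonym 'a chart = "'a set \<times> ('a \<Rightarrow> complex)"

definition complex_chart :: "'a topology \<Rightarrow> 'a chart \<Rightarrow> bool" where
  "complex_chart X = (\<lambda>(U, \<phi>). openin X U \<and> open (\<phi> ` U) \<and>
     homeomorphic_map (subtopology X U) (top_of_set (\<phi> ` U)) \<phi>)"

text \<open>Connected one-dimensional complex manifolds. Second countability is not required; it is
  automatic by Rado's theorem.\<close>

definition riemann_surface :: "'a topology \<Rightarrow> 'a chart set \<Rightarrow> bool" where
  "riemann_surface X A \<longleftrightarrow>
     topspace X \<noteq> {} \<and> Hausdorff_space X \<and> connected_space X \<and>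
     (\<forall>c\<in>A. complex_chart X c) \<and> (\<Union>(U, \<phi>)\<in>A. U) = topspace X \<and>
     (\<forall>(U, \<phi>)\<in>A. \<forall>(V, \<psi>)\<in>A. (\<psi> \<circ> inv_into U \<phi>) holomorphic_on \<phi> ` (U \<inter> V))"

definition restrict_atlas :: "'a set \<Rightarrow> 'a chart set \<Rightarrow> 'a chart set" where
  "restrict_atlas S A = (\<lambda>(U, \<phi>). (U \<inter> S, \<phi>)) ` A"

definition holomorphic_fun_on :: "'a chart set \<Rightarrow> ('a \<Rightarrow> complex) \<Rightarrow> 'a set \<Rightarrow> bool" where
  "holomorphic_fun_on A f W \<longleftrightarrow>
     (\<forall>(U, \<phi>)\<in>A. (f \<circ> inv_into U \<phi>) holomorphic_on \<phi> ` (U \<inter> W))"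

definition holomorphic_into ::
    "'a topology \<Rightarrow> 'a chart set \<Rightarrow> (complex \<Rightarrow> 'a) \<Rightarrow> complex set \<Rightarrow> bool" where
  "holomorphic_into X A g D \<longleftrightarrow>
     continuous_map (top_of_set D) X g \<and>
     (\<forall>(U, \<phi>)\<in>A. (\<phi> \<circ> g) holomorphic_on (D \<inter> g -` U))"

definition biholomorphism ::
    "'a topology \<Rightarrow> 'a chart set \<Rightarrow> 'a set \<Rightarrow> ('a \<Rightarrow> complex) \<Rightarrow> complex set \<Rightarrow> bool" where
  "biholomorphism X A U f D \<longleftrightarrow>
     openin X U \<and> open D \<and> bij_betw f U D \<and>
     holomorphic_fun_on A f U \<and> holomorphic_into X A (inv_into U f) D"

definition holomorphic_diffeo_into ::
    "'a topology \<Rightarrow> 'a chart set \<Rightarrow> (complex \<Rightarrow> 'a) \<Rightarrow> complex set \<Rightarrow> bool" where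
  "holomorphic_diffeo_into X A g D \<longleftrightarrow>
     inj_on g D \<and> biholomorphism X A (g ` D) (inv_into D g) D"


section \<open>Meromorphic functions on a Riemann surface\<close>

text \<open>As in \<^const>\<open>nicely_meromorphic_on\<close>, a meromorphic function, i.e. a holomorphic map to the
  Riemann sphere other than the constant \<open>\<infinity>\<close>, is represented by a complex-valued function
  with all removable singularities removed and with the value \<open>0\<close> at the poles; the poles are
  recovered by \<open>poles\<close>.\<close>

definition meromorphic_fun :: "'a chart set \<Rightarrow> ('a \<Rightarrow> complex) \<Rightarrow> bool" where
  "meromorphic_fun A f \<longleftrightarrow>
     (\<forall>(U, \<phi>)\<in>A. (f \<circ> inv_into U \<phi>) nicely_meromorphic_on \<phi> ` U)"

definition poles :: "'a chart set \<Rightarrow> ('a \<Rightarrow> complex) \<Rightarrow> 'a set" where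
  "poles A f = {p. \<exists>(U, \<phi>)\<in>A. p \<in> U \<and> is_pole (f \<circ> inv_into U \<phi>) (\<phi> p)}"

text \<open>A point is a ramification point of a nonconstant meromorphic function if the function is not
  injective on any neighbourhood of it. For a pole the convention above is harmless: close to the pole
  the function has no other zero, so on small neighbourhoods injectivity as a
  complex-valued function and as a map to the sphere are the same.\<close>

definition ramification_points :: "'a topology \<Rightarrow> ('a \<Rightarrow> complex) \<Rightarrow> 'a set" where
  "ramification_points X f =
     {p \<in> topspace X. \<not> (\<exists>V. openin X V \<and> p \<in> V \<and> inj_on f V)}"


section \<open>The compact Riemann surface of an algebraic curve\<close>

text \<open>A polynomial \<open>P(w,z)\<close> is an element of \<open>\<complex>[z][w]\<close>: the outer variable is \<open>w\<close>, so that
  \<open>degree P\<close> is the degree in \<open>w\<close>.\<close>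

definition poly_wz :: "complex poly poly \<Rightarrow> complex \<Rightarrow> complex \<Rightarrow> complex" where
  "poly_wz P a b = poly (poly P [:a:]) b"

definition regular_curve_points :: "complex poly poly \<Rightarrow> (complex \<times> complex) set" where
  "regular_curve_points P =
     {(a, b). poly_wz P a b = 0 \<and>
        (poly_wz (pderiv P) a b \<noteq> 0 \<or> poly_wz (map_poly pderiv P) a b \<noteq> 0)}"

text \<open>The compact Riemann surface of \<open>P(w,z) = 0\<close> is the compact Riemann surface obtained from the
  smooth part of the affine curve by adding finitely many points, with the coordinates as
  meromorphic functions; it is unique up to isomorphism and is treated here as any
  model \<open>(X, A, w, z)\<close>. The homeomorphism \<open>(w, z)\<close> below is automatically biholomorphic, since at each
  regular point of the curve one of the two coordinates is a local parameter.\<close>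

definition compact_riemann_surface_of_curve ::
    "complex poly poly \<Rightarrow> 'a topology \<Rightarrow> 'a chart set \<Rightarrow> ('a \<Rightarrow> complex) \<Rightarrow> ('a \<Rightarrow> complex) \<Rightarrow> bool"
  where
  "compact_riemann_surface_of_curve P X A w z \<longleftrightarrow>
     riemann_surface X A \<and> compact_space X \<and> meromorphic_fun A w \<and> meromorphic_fun A z \<and>
     (\<exists>E. finite E \<and> E \<subseteq> topspace X \<and> poles A w \<union> poles A z \<subseteq> E \<and>
        homeomorphic_map (subtopology X (topspace X - E)) (top_of_set (regular_curve_points P))
          (\<lambda>p. (w p, z p)))"


section \<open>Log-Riemann surfaces\<close>

text \<open>A straight cut is given by its base point \<open>a\<close> and its unit direction \<open>u\<close>.\<close>

definition straight_cut :: "complex \<times> complex \<Rightarrow> complex set" where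
  "straight_cut = (\<lambda>(a, u). {a + of_real t * u | t. 0 \<le> t})"

definition cut_system :: "(complex \<times> complex) set \<Rightarrow> bool" where
  "cut_system K \<longleftrightarrow>
     (\<forall>(a, u)\<in>K. norm u = 1) \<and>
     disjoint_family_on straight_cut K \<and>
     locally_finite_in euclidean (straight_cut ` K) \<and>
     discrete (fst ` K)"

text \<open>The two sides of the cut \<open>(a, u)\<close> near \<open>c\<close> are the two half-discs of \<open>ball c r\<close> on which
  \<open>Im ((\<zeta> - a) / u)\<close> is positive, respectively negative; the radius is such that the disc meets no
  other cut. By the identity theorem, two extensions that differ somewhere on the disc differ on
  every smaller disc around \<open>c\<close>.\<close>

definition two_sided_extension ::
    "'a topology \<Rightarrow> 'a chart set \<Rightarrow> 'a chart \<Rightarrow> (complex \<times> complex) set \<Rightarrow>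
     complex \<times> complex \<Rightarrow> complex \<Rightarrow> bool" where
  "two_sided_extension X A = (\<lambda>(U, \<phi>) K (a, u) c.
     \<exists>r>0. ball c r \<inter> \<Union>(straight_cut ` K) \<subseteq> straight_cut (a, u) \<and>
       (\<exists>g h. holomorphic_diffeo_into X A g (ball c r) \<and>
              holomorphic_diffeo_into X A h (ball c r) \<and>
              (\<forall>\<zeta>\<in>ball c r. Im ((\<zeta> - a) / u) > 0 \<longrightarrow> g \<zeta> = inv_into U \<phi> \<zeta>) \<and>
              (\<forall>\<zeta>\<in>ball c r. Im ((\<zeta> - a) / u) < 0 \<longrightarrow> h \<zeta> = inv_into U \<phi> \<zeta>) \<and>
              (\<exists>\<zeta>\<in>ball c r. g \<zeta> \<noteq> h \<zeta>)))"

definition log_chart :: "'a topology \<Rightarrow> 'a chart set \<Rightarrow> 'a chart \<Rightarrow> bool" where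
  "log_chart X A = (\<lambda>(U, \<phi>). \<exists>K. cut_system K \<and>
     biholomorphism X A U \<phi> (- \<Union>(straight_cut ` K)) \<and>
     (\<forall>k\<in>K. \<forall>c \<in> straight_cut k - {fst k}. two_sided_extension X A (U, \<phi>) K k c))"

definition log_riemann_surface :: "'a topology \<Rightarrow> 'a chart set \<Rightarrow> 'a chart set \<Rightarrow> bool" where
  "log_riemann_surface X A L \<longleftrightarrow>
     riemann_surface X A \<and>
     (\<forall>c\<in>L. log_chart X A c) \<and> (\<Union>(U, \<phi>)\<in>L. U) = topspace X \<and>
     (\<forall>(U, \<phi>)\<in>L. \<forall>(V, \<psi>)\<in>L. \<forall>\<zeta> \<in> \<psi> ` (U \<inter> V). \<phi> (inv_into V \<psi> \<zeta>) = \<zeta>)"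

text \<open>Well defined on the union of the chart domains, as the changes of charts are the identity.\<close>

definition log_projection :: "'a chart set \<Rightarrow> 'a \<Rightarrow> complex" where
  "log_projection L p = (THE c. \<exists>(U, \<phi>)\<in>L. p \<in> U \<and> c = \<phi> p)"

end

theory Submission
  imports Defs "HOL-Computational_Algebra.Field_as_Ring"
begin

text \<open>
Let \<open>\<pi>\<close> be the restriction of \<open>z\<close> to \<open>S\<close>, a local homeomorphism into the plane, and let \<open>B\<close> be the finite set
of values of \<open>z\<close> at the removed points. A \<^emph>\<open>section\<close> is a continuous right inverse of \<open>\<pi>\<close> on a plane set; a
log-chart is then the image of a section over a slit plane, and the chart map is \<open>\<pi>\<close> itself, so that all
changes of charts are the identity. The task is to put every point \<open>p\<close> of \<open>S\<close> into such an image.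

Choose a point \<open>z0\<close> close to \<open>z p\<close> and continue the inverse germ of \<open>\<pi>\<close> near \<open>p\<close> along all rays that start at
\<open>z0\<close>, as far as possible; this is the Mittag-Leffler star of the germ. Continuation is unique because \<open>\<pi>\<close> is
locally injective and \<open>S\<close> is Hausdorff. Compactness of \<open>X\<close> makes \<open>\<pi>\<close> evenly covered off \<open>B\<close>
(\<open>evenly_covered_S\<close>), so continuation can only get stuck at a point of \<open>B\<close>, and the star is the plane minus
finitely many radial half-lines with base points in \<open>B\<close> (\<open>Compl_cuts\<close>). For \<open>z0\<close> on no line through two
points of \<open>B\<close>, these half-lines are disjoint and contain no point of \<open>B\<close> beyond their base points, so the
section extends from either side over each further point of a cut by even covering.

It remains to see that the two extensions differ. If they agree at one point of the cut, then by continuation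
along the cut they agree at all of its points except possibly the base point \<open>b\<close>, and the section becomes single-valued
around \<open>b\<close>. A section on a punctured disc always extends over the centre
(\<open>section_extends_over_puncture\<close>): by compactness of \<open>X\<close> and finiteness of the fibres it has a limit in \<open>X\<close>,
and in a chart the extended section is an injective holomorphic map with left inverse \<open>z\<close>, whence the limit is
unramified. So the germ could have been continued beyond \<open>b\<close>, against the choice of the cut
(\<open>not_extends_over\<close>).

On the side of \<open>X\<close>, all of this rests on \<open>z\<close> being meromorphic with infinitely many values: by the identity theorem
and compactness such a function has finite fibres and finitely many poles and ramification points. Infinitely many values occur
because \<open>P\<close> and its \<open>w\<close>-derivative satisfy a Bezout relation with a nonzero right-hand side \<open>d(z)\<close>
(\<open>bezout_pderiv\<close>), so that over all but finitely many \<open>z\<close> the curve has a point, and it is a regular one.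
\<close>



section \<open>Local sections of a map into the plane\<close>

definition section_on :: "'a topology \<Rightarrow> ('a \<Rightarrow> complex) \<Rightarrow> complex set \<Rightarrow> (complex \<Rightarrow> 'a) \<Rightarrow> bool" where
  "section_on Y f D s \<longleftrightarrow> continuous_map (top_of_set D) Y s \<and> (\<forall>\<zeta>\<in>D. f (s \<zeta>) = \<zeta>)"

lemma section_onD:
  assumes "section_on Y f D s"
  shows "continuous_map (top_of_set D) Y s" "\<zeta> \<in> D \<Longrightarrow> f (s \<zeta>) = \<zeta>" "\<zeta> \<in> D \<Longrightarrow> s \<zeta> \<in> topspace Y"
  using assms continuous_map_image_subset_topspace[of "top_of_set D" Y s]
  unfolding section_on_def by auto

lemma section_on_subset: "section_on Y f D s \<Longrightarrow> D' \<subseteq> D \<Longrightarrow> section_on Y f D' s"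
  unfolding section_on_def by (meson continuous_map_from_subtopology_mono subsetD)

lemma section_on_cong:
  assumes "section_on Y f D s" "\<And>\<zeta>. \<zeta> \<in> D \<Longrightarrow> s' \<zeta> = s \<zeta>"
  shows "section_on Y f D s'"
  using assms unfolding section_on_def
  by (metis (no_types, lifting) continuous_map_eq topspace_euclidean_subtopology)

text \<open>Gluing, by the pasting lemma with one open set around each point; sections on unions of open sets are
obtained from it.\<close>

lemma section_on_local:
  assumes "\<And>\<zeta>. \<zeta> \<in> D \<Longrightarrow> \<exists>W t. open W \<and> \<zeta> \<in> W \<and> section_on Y f (D \<inter> W) t \<and> (\<forall>x\<in>D \<inter> W. s x = t x)"
  shows "section_on Y f D s"
proof -
  obtain W t where W: "\<And>\<zeta>. \<zeta> \<in> D \<Longrightarrow> open (W \<zeta>)" "\<And>\<zeta>. \<zeta> \<in> D \<Longrightarrow> \<zeta> \<in> W \<zeta>"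
      and t: "\<And>\<zeta>. \<zeta> \<in> D \<Longrightarrow> section_on Y f (D \<inter> W \<zeta>) (t \<zeta>)"
      and eq: "\<And>\<zeta> x. \<zeta> \<in> D \<Longrightarrow> x \<in> D \<inter> W \<zeta> \<Longrightarrow> s x = t \<zeta> x"
    using assms by metis
  have s: "section_on Y f (D \<inter> W \<zeta>) s" if "\<zeta> \<in> D" for \<zeta>
    using section_on_cong[OF t[OF that]] eq[OF that] by blast
  have "continuous_map (top_of_set D) Y s"
  proof (rule pasting_lemma[where I = D and T = "\<lambda>\<zeta>. D \<inter> W \<zeta>" and f = "\<lambda>_. s"])
    show "openin (top_of_set D) (D \<inter> W i)" if "i \<in> D" for i
      using W(1)[OF that] by (simp add: openin_open_Int)
    show "continuous_map (subtopology (top_of_set D) (D \<inter> W i)) Y s" if "i \<in> D" for i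
      using section_onD(1)[OF s[OF that]] by (simp add: subtopology_subtopology)
    show "\<exists>j. j \<in> D \<and> x \<in> D \<inter> W j \<and> s x = s x" if "x \<in> topspace (top_of_set D)" for x
      using that W(2) by auto
  qed auto
  moreover have "f (s \<zeta>) = \<zeta>" if "\<zeta> \<in> D" for \<zeta>
    using section_onD(2)[OF s[OF that], of \<zeta>] W(2)[OF that] that by auto
  ultimately show ?thesis by (simp add: section_on_def)
qed

lemma section_on_Un:
  assumes "section_on Y f D s" "section_on Y f D' t" "open D" "open D'"
    and "\<And>\<zeta>. \<zeta> \<in> D \<inter> D' \<Longrightarrow> s \<zeta> = t \<zeta>"
  shows "section_on Y f (D \<union> D') (\<lambda>\<zeta>. if \<zeta> \<in> D then s \<zeta> else t \<zeta>)"
proof (rule section_on_local)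
  fix \<zeta> assume "\<zeta> \<in> D \<union> D'"
  then consider "\<zeta> \<in> D" | "\<zeta> \<in> D'" by blast
  then show "\<exists>W u. open W \<and> \<zeta> \<in> W \<and> section_on Y f ((D \<union> D') \<inter> W) u \<and>
      (\<forall>x\<in>(D \<union> D') \<inter> W. (if x \<in> D then s x else t x) = u x)"
  proof cases
    case 1
    have "(D \<union> D') \<inter> D = D" by blast
    then show ?thesis using 1 assms(1,3) by (intro exI[of _ D] exI[of _ s]) auto
  next
    case 2
    have "(D \<union> D') \<inter> D' = D'" by blast
    then show ?thesis using 2 assms(2,4,5) by (intro exI[of _ D'] exI[of _ t]) auto
  qed
qed

text \<open>The two hypotheses that make the continuation of sections unique.\<close>

locale local_injection =
  fixes Y :: "'a topology" and f :: "'a \<Rightarrow> complex"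
  assumes hausdorff: "Hausdorff_space Y"
    and locally_injective: "x \<in> topspace Y \<Longrightarrow> \<exists>N. openin Y N \<and> x \<in> N \<and> inj_on f N"
begin

text \<open>The set where two sections agree is closed because \<open>Y\<close> is Hausdorff, and open because \<open>f\<close> is
locally injective.\<close>

lemma section_unique:
  assumes D: "connected D" and s: "section_on Y f D s" and t: "section_on Y f D t"
    and a: "a \<in> D" "s a = t a" and \<zeta>: "\<zeta> \<in> D"
  shows "s \<zeta> = t \<zeta>"
proof -
  let ?E = "{x \<in> D. s x = t x}"
  have "closedin (top_of_set D) ?E"
    using closedin_continuous_maps_eq[OF hausdorff section_onD(1)[OF s] section_onD(1)[OF t]] by simp
  moreover have "openin (top_of_set D) ?E"
  proof (subst openin_subopen, intro ballI)
    fix x assume x: "x \<in> ?E"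
    then have "s x \<in> topspace Y" using section_onD(3)[OF s] by blast
    then obtain N where N: "openin Y N" "s x \<in> N" "inj_on f N" using locally_injective by blast
    let ?T = "{y \<in> D. s y \<in> N} \<inter> {y \<in> D. t y \<in> N}"
    have "openin (top_of_set D) ?T"
      using openin_continuous_map_preimage[OF section_onD(1)[OF s] N(1)]
        openin_continuous_map_preimage[OF section_onD(1)[OF t] N(1)] by auto
    moreover have "x \<in> ?T" using x N(2) by auto
    moreover have "?T \<subseteq> ?E"
    proof
      fix y assume y: "y \<in> ?T"
      then have "f (s y) = f (t y)" using section_onD(2)[OF s] section_onD(2)[OF t] by auto
      then show "y \<in> ?E" using y N(3) by (auto dest: inj_onD)
    qed
    ultimately show "\<exists>T. openin (top_of_set D) T \<and> x \<in> T \<and> T \<subseteq> ?E" by blast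
  qed
  ultimately have "?E = {} \<or> ?E = D" using D unfolding connected_clopen by blast
  then show ?thesis using a \<zeta> by blast
qed

end

text \<open>The topological content of a finite branched covering with the branch points removed from the
total space. The set \<open>B\<close> contains the values at the branch points; over a point of \<open>B\<close> the remaining sheets
still carry local sections. The last condition says that a sheet which is unbranched around a missing point is
not missing that point.\<close>

locale branched_projection = local_injection Y f for Y :: "'a topology" and f :: "'a \<Rightarrow> complex" +
  fixes B :: "complex set"
  assumes finite_branch_values: "finite B"
    and evenly_covered: "c \<notin> B \<Longrightarrow> \<exists>r>0. \<forall>x\<in>topspace Y. f x \<in> ball c r \<longrightarrow>
           (\<exists>s. section_on Y f (ball c r) s \<and> s (f x) = x)"
    and local_section: "x \<in> topspace Y \<Longrightarrow> \<exists>r>0. \<exists>s. section_on Y f (ball (f x) r) s \<and> s (f x) = x"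
    and puncture: "0 < r \<Longrightarrow> section_on Y f (ball b r - {b}) s \<Longrightarrow>
           \<exists>s'. section_on Y f (ball b r) s' \<and> (\<forall>\<zeta>\<in>ball b r - {b}. s' \<zeta> = s \<zeta>)"


lemma convex_tube:
  fixes K :: "complex set"
  assumes "convex K"
  shows "convex (\<Union>x\<in>K. ball x \<delta>)"
proof -
  have "(\<Union>x\<in>K. ball x \<delta>) = {x + y |x y. x \<in> K \<and> y \<in> ball 0 \<delta>}"
    apply (auto simp: dist_norm)
    subgoal for x xa by (intro exI[of _ xa] exI[of _ "x - xa"]) (auto simp: norm_minus_commute)
    done
  moreover have "\<dots> = (\<Union>x\<in>K. \<Union>y\<in>ball 0 \<delta>. {x + y})" by blast
  ultimately show ?thesis using convex_sums[OF \<open>convex K\<close> convex_ball[of 0 \<delta>]] by metis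
qed

lemma nearby_point_on_segment:
  fixes z0 c :: complex
  assumes "c \<noteq> z0" "r > 0"
  obtains c' where "c' \<in> closed_segment z0 c" "c' \<in> ball c r" "dist z0 c' < dist z0 c"
proof -
  define d where "d = min 1 (r / (2 * dist z0 c))"
  define c' where "c' = c + d *\<^sub>R (z0 - c)"
  have d: "0 < d" "d \<le> 1" "d * dist z0 c < r"
    using assms by (auto simp: d_def min_def field_simps)
  show ?thesis
  proof (rule that)
    show "c' \<in> closed_segment z0 c"
      using d unfolding closed_segment_commute[of z0]
      by (auto simp: in_segment c'_def algebra_simps intro!: exI[of _ d])
    have "dist c c' = d * dist z0 c" using d(1) by (simp add: c'_def dist_norm)
    then show "c' \<in> ball c r" using d(3) by simp
    have "z0 - c' = (1 - d) *\<^sub>R (z0 - c)" by (simp add: c'_def algebra_simps)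
    then have "dist z0 c' = (1 - d) * dist z0 c" using d by (simp add: dist_norm)
    then show "dist z0 c' < dist z0 c"
      using mult_pos_pos[OF d(1), of "dist z0 c"] assms(1) by (simp add: algebra_simps)
  qed
qed

section \<open>The star of a germ of sections\<close>

text \<open>The base point of the star. Genericity, with \<open>b = b'\<close> included, says that \<open>z0\<close> is not in \<open>B\<close> and
that no ray from \<open>z0\<close> meets two points of \<open>B\<close>.\<close>

locale star_base = branched_projection Y f B for Y :: "'a topology" and f B +
  fixes z0 :: complex and p0 :: 'a
  assumes p0: "p0 \<in> topspace Y" "f p0 = z0"
    and generic: "b \<in> B \<Longrightarrow> b' \<in> B \<Longrightarrow> z0 \<notin> affine hull {b, b'}"
begin

definition star_shaped :: "complex set \<Rightarrow> bool" where
  "star_shaped D \<longleftrightarrow> z0 \<in> D \<and> (\<forall>\<zeta>\<in>D. closed_segment z0 \<zeta> \<subseteq> D)"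

text \<open>The Mittag-Leffler star of the germ of section at \<open>z0\<close> with value \<open>p0\<close>. Taking open star-shaped
sets instead of individual rays lets continuity of the resulting section come from gluing alone.\<close>

definition star :: "complex set" where
  "star = \<Union>{D. open D \<and> star_shaped D \<and> (\<exists>s. section_on Y f D s \<and> s z0 = p0)}"

lemma star_shaped_connected: "star_shaped D \<Longrightarrow> connected D"
  by (rule starlike_imp_connected) (auto simp: starlike_def star_shaped_def)

lemma open_star: "open star"
  unfolding star_def by blast

lemma subset_star:
  "open D \<Longrightarrow> star_shaped D \<Longrightarrow> section_on Y f D s \<Longrightarrow> s z0 = p0 \<Longrightarrow> D \<subseteq> star"
  unfolding star_def by blast

lemma star_segment: "\<zeta> \<in> star \<Longrightarrow> closed_segment z0 \<zeta> \<subseteq> star"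
  unfolding star_def star_shaped_def by blast

lemma z0_notin: "z0 \<notin> B"
  using generic[of z0 z0] by auto

lemma z0_in_star: "z0 \<in> star"
proof -
  obtain r where "r > 0" and r: "\<forall>x\<in>topspace Y. f x \<in> ball z0 r \<longrightarrow>
           (\<exists>s. section_on Y f (ball z0 r) s \<and> s (f x) = x)"
    using evenly_covered[OF z0_notin] by blast
  then obtain s where "section_on Y f (ball z0 r) s" "s z0 = p0" using p0 by fastforce
  moreover have "star_shaped (ball z0 r)"
    unfolding star_shaped_def
    using \<open>r > 0\<close> closed_segment_subset[OF _ _ convex_ball[of z0 r]] centre_in_ball by blast
  ultimately show ?thesis using subset_star[of "ball z0 r" s] \<open>r > 0\<close> by auto
qed

text \<open>Two sections on star-shaped sets agree on the intersection, because it is again star-shaped, hence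
connected, and contains \<open>z0\<close>.\<close>

lemma star_section: "\<exists>s. section_on Y f star s \<and> s z0 = p0"
proof -
  define I where "I = {D. open D \<and> star_shaped D \<and> (\<exists>s. section_on Y f D s \<and> s z0 = p0)}"
  have "\<exists>t. \<forall>D\<in>I. section_on Y f D (t D) \<and> t D z0 = p0"
    by (rule bchoice) (auto simp: I_def)
  then obtain t where t: "\<And>D. D \<in> I \<Longrightarrow> section_on Y f D (t D)" "\<And>D. D \<in> I \<Longrightarrow> t D z0 = p0"
    by metis
  have I: "open D" "star_shaped D" if "D \<in> I" for D using that by (auto simp: I_def)
  have agree: "t D \<zeta> = t D' \<zeta>" if "D \<in> I" "D' \<in> I" "\<zeta> \<in> D" "\<zeta> \<in> D'" for D D' \<zeta>
  proof (rule section_unique[where D = "D \<inter> D'" and a = z0])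
    have "star_shaped (D \<inter> D')" using I(2)[OF that(1)] I(2)[OF that(2)] by (auto simp: star_shaped_def)
    then show "connected (D \<inter> D')" "z0 \<in> D \<inter> D'"
      by (auto simp: star_shaped_connected) (auto simp: star_shaped_def)
    show "section_on Y f (D \<inter> D') (t D)" "section_on Y f (D \<inter> D') (t D')"
      using t(1) that section_on_subset by (metis inf_le1, metis inf_le2)
  qed (use that t(2) in auto)
  define s where "s \<zeta> = t (SOME D. D \<in> I \<and> \<zeta> \<in> D) \<zeta>" for \<zeta>
  have s: "s \<zeta> = t D \<zeta>" if "D \<in> I" "\<zeta> \<in> D" for D \<zeta>
    using someI[of "\<lambda>D. D \<in> I \<and> \<zeta> \<in> D", OF conjI[OF that]] agree that unfolding s_def by blast
  have star: "star = \<Union>I" by (simp add: star_def I_def)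
  have "section_on Y f star s"
  proof (rule section_on_local)
    fix \<zeta> assume "\<zeta> \<in> star"
    then obtain D where D: "D \<in> I" "\<zeta> \<in> D" using star by blast
    then have "star \<inter> D = D" using star by blast
    then show "\<exists>W u. open W \<and> \<zeta> \<in> W \<and> section_on Y f (star \<inter> W) u \<and> (\<forall>x\<in>star \<inter> W. s x = u x)"
      using D t(1) I s by (intro exI[of _ D] exI[of _ "t D"]) auto
  qed
  moreover have "s z0 = p0"
    using z0_in_star s t(2) star by blast
  ultimately show ?thesis by blast
qed

text \<open>A disc section that continues the star section radially carries the star at least as far as the centre
of the disc. A thin tube around the segment from \<open>z0\<close> to the centre is convex and is covered by the disc and a
tube on which the star section already lives, so the two sections glue on it.\<close>

lemma star_step:
  assumes s: "section_on Y f star s" "s z0 = p0"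
    and c': "c' \<in> star" "c' \<in> closed_segment z0 c" "c' \<in> ball c r"
    and g: "section_on Y f (ball c r) g" "g c' = s c'"
  shows "c \<in> star"
proof -
  let ?K = "closed_segment z0 c'" and ?L = "closed_segment z0 c"
  have "?K \<subseteq> star" using star_segment c'(1) by blast
  then obtain \<epsilon> where \<epsilon>: "\<epsilon> > 0" "(\<Union>x\<in>?K. ball x \<epsilon>) \<subseteq> star"
    using compact_subset_open_imp_ball_epsilon_subset[OF compact_segment open_star] by metis
  (* Points between c' and c have distance at most dist c c' from c, so their tube of this radius stays in the disc. *)
  define \<delta> where "\<delta> = min \<epsilon> (r - dist c c')"
  have \<delta>: "\<delta> > 0" "\<delta> \<le> \<epsilon>" "\<delta> \<le> r - dist c c'" using \<epsilon>(1) c'(3) by (auto simp: \<delta>_def)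
  let ?T = "\<Union>x\<in>?K. ball x \<delta>" and ?N = "\<Union>x\<in>?L. ball x \<delta>"
  have T: "open ?T" "convex ?T" "?T \<subseteq> star" "c' \<in> ?T" "z0 \<in> ?T"
    using \<epsilon> \<delta> convex_tube[of ?K \<delta>] by (auto simp: subset_eq) force+
  have L: "?L = ?K \<union> closed_segment c' c" using c'(2) by (simp add: Un_closed_segment)
  have near: "dist c x \<le> dist c c'" if "x \<in> closed_segment c' c" for x
    using segment_bound(2)[OF that] by (simp add: dist_norm norm_minus_commute)
  have "?N \<subseteq> ?T \<union> ball c r"
  proof
    fix y assume "y \<in> ?N"
    then obtain x where x: "x \<in> ?L" "dist x y < \<delta>" by auto
    show "y \<in> ?T \<union> ball c r"
    proof (cases "x \<in> ?K")
      case False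
      then have "x \<in> closed_segment c' c" using x L by blast
      then have "dist c y < dist c c' + \<delta>" using near x(2) dist_triangle[of c y x] by force
      then show ?thesis using \<delta>(3) by auto
    qed (use x in auto)
  qed
  moreover have "section_on Y f (?T \<union> ball c r) (\<lambda>\<zeta>. if \<zeta> \<in> ?T then s \<zeta> else g \<zeta>)"
  proof (rule section_on_Un)
    fix \<zeta> assume \<zeta>: "\<zeta> \<in> ?T \<inter> ball c r"
    show "s \<zeta> = g \<zeta>"
    proof (rule section_unique[of "?T \<inter> ball c r" s g c'])
      show "connected (?T \<inter> ball c r)"
        by (rule convex_connected[OF convex_Int[OF T(2) convex_ball]])
      show "section_on Y f (?T \<inter> ball c r) s"
        by (rule section_on_subset[OF s(1)]) (use T(3) in blast)
      show "section_on Y f (?T \<inter> ball c r) g"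
        by (rule section_on_subset[OF g(1)]) blast
      show "c' \<in> ?T \<inter> ball c r" using T(4) c'(3) by blast
    qed (use g \<zeta> in simp_all)
  qed (use T(1) g(1) section_on_subset[OF s(1) T(3)] open_ball in blast)+
  ultimately have "section_on Y f ?N (\<lambda>\<zeta>. if \<zeta> \<in> ?T then s \<zeta> else g \<zeta>)"
    using section_on_subset by blast
  moreover have "star_shaped ?N"
  proof -
    have "z0 \<in> ?N" using \<delta>(1) by force
    then show ?thesis using closed_segment_subset[OF _ _ convex_tube[of ?L \<delta>]] by (auto simp: star_shaped_def)
  qed
  moreover have "open ?N" by blast
  moreover have "(if z0 \<in> ?T then s z0 else g z0) = p0" using T(5) s(2) by simp
  ultimately have "?N \<subseteq> star"
    using subset_star[of ?N "\<lambda>\<zeta>. if \<zeta> \<in> ?T then s \<zeta> else g \<zeta>"] by blast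
  then show ?thesis using \<delta>(1) by force
qed

text \<open>Every obstruction to radial continuation is a point of \<open>B\<close>: at the first point of the segment
outside the star, an evenly covered disc would allow one more step.\<close>

lemma not_in_starE:
  assumes \<zeta>: "\<zeta> \<notin> star"
  obtains b where "b \<in> B" "b \<notin> star" "b \<in> closed_segment z0 \<zeta>"
proof -
  obtain s where s: "section_on Y f star s" "s z0 = p0" using star_section by blast
  let ?C = "closed_segment z0 \<zeta> - star"
  have "compact ?C" using compact_diff[OF compact_segment open_star] .
  moreover have "?C \<noteq> {}" using \<zeta> by auto
  ultimately obtain c where c: "c \<in> ?C" and cmin: "\<And>y. y \<in> ?C \<Longrightarrow> dist z0 c \<le> dist z0 y"
    using continuous_attains_inf[of ?C "dist z0"] by (force intro: continuous_intros)
  have "c \<noteq> z0" using c z0_in_star by auto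
  have "c \<in> B"
  proof (rule ccontr)
    assume "c \<notin> B"
    then obtain r where r: "r > 0" "\<forall>x\<in>topspace Y. f x \<in> ball c r \<longrightarrow>
           (\<exists>s. section_on Y f (ball c r) s \<and> s (f x) = x)"
      using evenly_covered by blast
    obtain c' where c': "c' \<in> closed_segment z0 c" "c' \<in> ball c r" "dist z0 c' < dist z0 c"
      using nearby_point_on_segment[OF \<open>c \<noteq> z0\<close> r(1)] .
    have "closed_segment z0 c \<subseteq> closed_segment z0 \<zeta>" using c by (simp add: subset_closed_segment)
    then have star: "c' \<in> star" using cmin[of c'] c' by fastforce
    have "f (s c') \<in> ball c r" using section_onD(2)[OF s(1) star] c'(2) by simp
    then obtain g where "section_on Y f (ball c r) g" "g c' = s c'"
      using r(2) section_onD(2,3)[OF s(1) star] by force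
    then have "c \<in> star" using star_step[OF s star c'(1)] c'(2) by auto
    then show False using c by blast
  qed
  then show ?thesis using c that by blast
qed

end

section \<open>Geometry of straight cuts\<close>

lemma closed_straight_cut: "closed (straight_cut k)"
proof -
  obtain a u where k: "k = (a, u)" by fastforce
  have "straight_cut k = (+) a ` ((\<lambda>t. t *\<^sub>R u) ` {0..})"
    by (auto simp: straight_cut_def k scaleR_conv_of_real image_iff)
  moreover have "closed ((\<lambda>t. t *\<^sub>R u) ` {0::real..})"
  proof (cases "u = 0")
    case False
    then have "inj (\<lambda>t::real. t *\<^sub>R u)" by (auto simp: inj_on_def)
    then show ?thesis
      using closed_injective_linear_image[of "{0::real..}" "\<lambda>t. t *\<^sub>R u"] by (simp add: linear_iff algebra_simps)
  qed (auto simp: image_constant_conv)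
  ultimately show ?thesis by (metis closed_translation)
qed

text \<open>The half-line from \<open>b\<close> pointing away from \<open>z0\<close> is the shadow of \<open>b\<close> as seen from \<open>z0\<close>. This
turns statements on cuts into statements on segments, for which the star is made.\<close>

lemma straight_cut_iff_base_between:
  assumes "b \<noteq> z0"
  shows "\<zeta> \<in> straight_cut (b, sgn (b - z0)) \<longleftrightarrow> b \<in> closed_segment z0 \<zeta>"
proof -
  define d where "d = norm (b - z0)"
  have d: "d > 0" using assms by (simp add: d_def)
  have u: "b - z0 = d *\<^sub>R sgn (b - z0)" using d by (simp add: d_def sgn_div_norm)
  show ?thesis
  proof
    assume "\<zeta> \<in> straight_cut (b, sgn (b - z0))"
    then obtain t where t: "t \<ge> 0" "\<zeta> = b + t *\<^sub>R sgn (b - z0)"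
      by (auto simp: straight_cut_def scaleR_conv_of_real)
    define v where "v = d / (d + t)"
    have v: "0 \<le> v" "v \<le> 1" "v * (d + t) = d" using d t(1) by (auto simp: v_def)
    have "\<zeta> - z0 = (d + t) *\<^sub>R sgn (b - z0)" using t(2) u by (simp add: algebra_simps)
    then have "v *\<^sub>R (\<zeta> - z0) = b - z0" using v(3) u by simp
    then have "b = (1 - v) *\<^sub>R z0 + v *\<^sub>R \<zeta>" by (simp add: algebra_simps)
    then show "b \<in> closed_segment z0 \<zeta>" using v(1,2) by (auto simp: in_segment)
  next
    assume "b \<in> closed_segment z0 \<zeta>"
    then obtain v where v: "0 \<le> v" "v \<le> 1" "b = (1 - v) *\<^sub>R z0 + v *\<^sub>R \<zeta>" by (auto simp: in_segment)
    then have v0: "v > 0" using assms by (cases "v = 0") auto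
    have "b - z0 = v *\<^sub>R (\<zeta> - z0)" using v(3) by (simp add: algebra_simps)
    then have "\<zeta> - z0 = (1 / v) *\<^sub>R (b - z0)" using v0 by simp
    then have "\<zeta> = b + (1 / v - 1) *\<^sub>R (b - z0)" by (simp add: algebra_simps)
    also have "\<dots> = b + ((1 / v - 1) * d) *\<^sub>R sgn (b - z0)" by (subst u) simp
    finally show "\<zeta> \<in> straight_cut (b, sgn (b - z0))"
      using v(2) v0 d unfolding straight_cut_def scaleR_conv_of_real
      by (auto simp: intro!: exI[of _ "(1 / v - 1) * d"])
  qed
qed

lemma Im_eq_0_imp_on_straight_cut:
  assumes "norm u = 1" "0 < t" "c = a + of_real t * u" "dist c \<zeta> < t" "Im ((\<zeta> - a) / u) = 0"
  shows "\<zeta> \<in> straight_cut (a, u)"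
proof -
  define x where "x = Re ((\<zeta> - a) / u)"
  have u: "u \<noteq> 0" using assms(1) by auto
  have "(\<zeta> - a) / u = of_real x" using assms(5) by (simp add: complex_eq_iff x_def)
  then have \<zeta>: "\<zeta> = a + of_real x * u" unfolding nonzero_divide_eq_eq[OF u] by (simp add: algebra_simps)
  have "c - \<zeta> = of_real (t - x) * u" using assms(3) \<zeta> by (simp add: algebra_simps)
  then have "\<bar>t - x\<bar> < t" using assms(1,4) by (simp add: dist_norm norm_mult del: of_real_diff)
  then have "x > 0" by auto
  then show "\<zeta> \<in> straight_cut (a, u)" using \<zeta> u by (auto simp: straight_cut_def intro!: exI[of _ x])
qed

lemma Im_on_straight_cut:
  assumes "\<zeta> \<in> straight_cut (a, u)"
  shows "Im ((\<zeta> - a) / u) = 0"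
  using assms by (auto simp: straight_cut_def)

lemma sides_near_straight_cut:
  assumes "norm u = 1" "x \<in> straight_cut (a, u)" "0 < \<delta>"
  obtains y y' where "y \<in> ball x \<delta>" "Im ((y - a) / u) > 0" "y' \<in> ball x \<delta>" "Im ((y' - a) / u) < 0"
proof -
  have u: "u \<noteq> 0" using assms(1) by auto
  obtain t where x: "x = a + of_real t * u" using assms(2) by (auto simp: straight_cut_def)
  define v where "v = of_real (\<delta> / 2) * \<i> * u"
  have "norm v = \<delta> / 2" using assms(1,3) by (simp add: v_def norm_mult)
  then have "x + v \<in> ball x \<delta>" "x - v \<in> ball x \<delta>" using assms(3) by (auto simp: dist_norm)
  moreover have "(x + v - a) / u = of_real t + of_real (\<delta> / 2) * \<i>" "(x - v - a) / u = of_real t - of_real (\<delta> / 2) * \<i>"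
    unfolding nonzero_divide_eq_eq[OF u] by (simp_all add: x v_def algebra_simps)
  ultimately show ?thesis using that[of "x + v" "x - v"] assms(3) by simp
qed

lemma convex_sides: "convex {\<zeta>. Im ((\<zeta> - a) / u) > 0}" "convex {\<zeta>. Im ((\<zeta> - a) / u) < 0}"
proof -
  have l: "linear (\<lambda>\<zeta>. Im (\<zeta> / u))"
    by (intro linearI) (simp_all add: divide_inverse distrib_right)
  have "{\<zeta>. Im ((\<zeta> - a) / u) > 0} = (\<lambda>\<zeta>. Im (\<zeta> / u)) -` {Im (a / u)<..}"
    "{\<zeta>. Im ((\<zeta> - a) / u) < 0} = (\<lambda>\<zeta>. Im (\<zeta> / u)) -` {..<Im (a / u)}"
    by (auto simp: divide_inverse left_diff_distrib)
  then show "convex {\<zeta>. Im ((\<zeta> - a) / u) > 0}" "convex {\<zeta>. Im ((\<zeta> - a) / u) < 0}"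
    using convex_linear_vimage[OF l] by simp_all
qed

section \<open>The cuts bounding the star\<close>

context star_base
begin

definition cut :: "complex \<Rightarrow> complex \<times> complex" where
  "cut b = (b, sgn (b - z0))"

definition cuts :: "(complex \<times> complex) set" where
  "cuts = cut ` (B - star)"

lemma mem_cut_iff: "b \<in> B \<Longrightarrow> \<zeta> \<in> straight_cut (cut b) \<longleftrightarrow> b \<in> closed_segment z0 \<zeta>"
  unfolding cut_def by (rule straight_cut_iff_base_between) (use z0_notin in auto)

lemma base_in_cut: "b \<in> B \<Longrightarrow> b \<in> straight_cut (cut b)"
  by (simp add: mem_cut_iff)

text \<open>If two cuts met, their base points would lie on one ray from \<open>z0\<close>, against genericity.\<close>

lemma cut_disjoint:
  assumes "b \<in> B" "b' \<in> B" "\<zeta> \<in> straight_cut (cut b)" "\<zeta> \<in> straight_cut (cut b')"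
  shows "b = b'"
proof (rule ccontr)
  assume "b \<noteq> b'"
  obtain v v' where v: "b = (1 - v) *\<^sub>R z0 + v *\<^sub>R \<zeta>" "b' = (1 - v') *\<^sub>R z0 + v' *\<^sub>R \<zeta>"
    using assms(3,4) unfolding mem_cut_iff[OF assms(1)] mem_cut_iff[OF assms(2)] in_segment by blast
  then have ne: "v' - v \<noteq> 0" using \<open>b \<noteq> b'\<close> by auto
  have "v' *\<^sub>R b - v *\<^sub>R b' = (v' - v) *\<^sub>R z0" unfolding v by (simp add: algebra_simps)
  then have "inverse (v' - v) *\<^sub>R (v' *\<^sub>R b - v *\<^sub>R b') = z0" using ne by simp
  then have "z0 = (v' / (v' - v)) *\<^sub>R b + (- v / (v' - v)) *\<^sub>R b'"
    by (simp add: scaleR_right_diff_distrib divide_inverse mult.commute)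
  moreover have "v' / (v' - v) + (- v / (v' - v)) = 1" using ne by (simp flip: diff_divide_distrib)
  ultimately have "z0 \<in> affine hull {b, b'}" unfolding affine_hull_2 by blast
  then show False using generic assms by blast
qed

text \<open>A point outside the star lies in the shadow of an obstruction from \<open>B\<close>. Conversely, the star contains
with a point the segment from \<open>z0\<close> to it, so nothing in the shadow of a point outside the star belongs to the star.\<close>

lemma Compl_cuts: "- \<Union>(straight_cut ` cuts) = star"
proof (intro equalityI subsetI)
  fix \<zeta> assume \<zeta>: "\<zeta> \<in> - \<Union>(straight_cut ` cuts)"
  show "\<zeta> \<in> star"
  proof (rule ccontr)
    assume "\<zeta> \<notin> star"
    then obtain b where "b \<in> B" "b \<notin> star" "b \<in> closed_segment z0 \<zeta>" by (rule not_in_starE)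
    then have "\<zeta> \<in> \<Union>(straight_cut ` cuts)" using mem_cut_iff by (auto simp: cuts_def)
    then show False using \<zeta> by blast
  qed
next
  fix \<zeta> assume "\<zeta> \<in> star"
  then have "closed_segment z0 \<zeta> \<subseteq> star" by (rule star_segment)
  then show "\<zeta> \<in> - \<Union>(straight_cut ` cuts)" using mem_cut_iff by (auto simp: cuts_def)
qed

lemma cut_system_cuts: "cut_system cuts"
proof -
  have fin: "finite cuts" using finite_branch_values by (simp add: cuts_def)
  have "norm u = 1" if "(a, u) \<in> cuts" for a u
    using that z0_notin by (auto simp: cuts_def cut_def norm_sgn)
  moreover have "disjoint_family_on straight_cut cuts"
    unfolding disjoint_family_on_def cuts_def using cut_disjoint by blast
  moreover have "locally_finite_in euclidean (straight_cut ` cuts)"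
    using fin by (intro finite_imp_locally_finite_in) auto
  moreover have "discrete (fst ` cuts)"
    using fin by (intro discreteI) (simp add: isolated_in_islimpt_iff islimpt_finite)
  ultimately show ?thesis unfolding cut_system_def by blast
qed

lemma ball_missing_other_cuts:
  assumes "b \<in> B" "c \<in> straight_cut (cut b)"
  obtains r where "r > 0" "ball c r \<inter> \<Union>(straight_cut ` cuts) \<subseteq> straight_cut (cut b)"
proof -
  let ?O = "\<Union>b'\<in>B - {b}. straight_cut (cut b')"
  have "closed ?O" using finite_branch_values closed_straight_cut by blast
  moreover have "c \<notin> ?O" using cut_disjoint assms by blast
  ultimately obtain r where "r > 0" "ball c r \<subseteq> - ?O"
    by (metis ComplI openE open_Compl)
  then show ?thesis by (intro that[of r]) (auto simp: cuts_def)
qed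

lemma off_cut_in_star:
  assumes "ball c r \<inter> \<Union>(straight_cut ` cuts) \<subseteq> straight_cut (cut b)" "\<zeta> \<in> ball c r"
    "\<zeta> \<notin> straight_cut (cut b)"
  shows "\<zeta> \<in> star"
  using assms Compl_cuts by blast

lemma norm_direction: "b \<in> B \<Longrightarrow> norm (sgn (b - z0)) = 1"
  using z0_notin by (auto simp: norm_sgn)

lemma extend_from_convex:
  assumes s: "section_on Y f star s"
    and cover: "\<forall>x\<in>topspace Y. f x \<in> ball c r \<longrightarrow> (\<exists>s. section_on Y f (ball c r) s \<and> s (f x) = x)"
    and H: "convex H" "H \<subseteq> ball c r" "H \<subseteq> star" "y \<in> H"
  obtains g where "section_on Y f (ball c r) g" "\<forall>\<zeta>\<in>H. g \<zeta> = s \<zeta>"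
proof -
  have "y \<in> star" "y \<in> ball c r" using H by auto
  then obtain g where g: "section_on Y f (ball c r) g" "g y = s y"
    using cover section_onD(2,3)[OF s \<open>y \<in> star\<close>] by force
  have "g \<zeta> = s \<zeta>" if "\<zeta> \<in> H" for \<zeta>
    using that H g section_unique[OF convex_connected[OF H(1)] section_on_subset[OF g(1) H(2)]
        section_on_subset[OF s H(3)]] by blast
  then show ?thesis using that g(1) by blast
qed

text \<open>Genericity keeps \<open>c\<close> out of \<open>B\<close>, so small discs around \<open>c\<close> are evenly covered, and both open half-discs
are convex subsets of the star. The last conclusion says that the diameter between them lies on the cut.\<close>

lemma extensions_from_both_sides:
  assumes s: "section_on Y f star s" and b: "b \<in> B" "b \<notin> star"
    and c: "c \<in> straight_cut (cut b) - {b}"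
  obtains r g h where "r > 0" "ball c r \<inter> \<Union>(straight_cut ` cuts) \<subseteq> straight_cut (cut b)"
    "section_on Y f (ball c r) g" "section_on Y f (ball c r) h"
    "\<forall>\<zeta>\<in>ball c r. Im ((\<zeta> - b) / sgn (b - z0)) > 0 \<longrightarrow> g \<zeta> = s \<zeta>"
    "\<forall>\<zeta>\<in>ball c r. Im ((\<zeta> - b) / sgn (b - z0)) < 0 \<longrightarrow> h \<zeta> = s \<zeta>"
    "\<forall>\<zeta>\<in>ball c r \<inter> star. Im ((\<zeta> - b) / sgn (b - z0)) \<noteq> 0"
proof -
  let ?u = "sgn (b - z0)"
  obtain r1 where r1: "r1 > 0" "ball c r1 \<inter> \<Union>(straight_cut ` cuts) \<subseteq> straight_cut (cut b)"
    using ball_missing_other_cuts b c by blast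
  obtain t where t: "t \<ge> 0" "c = b + of_real t * ?u" using c by (auto simp: cut_def straight_cut_def)
  then have "t > 0" using c by (cases "t = 0") auto
  (* A point of B is on its own cut, so it can be on this one only as its base point. *)
  have "c \<notin> B" using c cut_disjoint[OF b(1)] base_in_cut by blast
  then obtain r2 where r2: "r2 > 0" "\<forall>x\<in>topspace Y. f x \<in> ball c r2 \<longrightarrow>
           (\<exists>s. section_on Y f (ball c r2) s \<and> s (f x) = x)"
    using evenly_covered by blast
  (* The bound t, the distance of c from the base point, keeps the line through the cut inside the cut. *)
  define r where "r = min t (min r1 r2)"
  have r: "r > 0" "r \<le> t" "r \<le> r1" "r \<le> r2" using \<open>t > 0\<close> r1(1) r2(1) by (auto simp: r_def)
  have cover: "\<forall>x\<in>topspace Y. f x \<in> ball c r \<longrightarrow> (\<exists>s. section_on Y f (ball c r) s \<and> s (f x) = x)"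
    using r2(2) section_on_subset[OF _ subset_ball[OF r(4)]] subset_ball[OF r(4)] by blast
  have sub: "ball c r \<inter> \<Union>(straight_cut ` cuts) \<subseteq> straight_cut (cut b)"
    using r1(2) r(3) by auto
  have star: "\<zeta> \<in> star" if "\<zeta> \<in> ball c r" "Im ((\<zeta> - b) / ?u) \<noteq> 0" for \<zeta>
    using off_cut_in_star[OF sub that(1)] Im_on_straight_cut that(2) unfolding cut_def by blast
  have on_cut: "Im ((\<zeta> - b) / ?u) \<noteq> 0" if "\<zeta> \<in> ball c r \<inter> star" for \<zeta>
  proof
    assume "Im ((\<zeta> - b) / ?u) = 0"
    then have "\<zeta> \<in> straight_cut (cut b)"
      using Im_eq_0_imp_on_straight_cut[OF norm_direction[OF b(1)] \<open>t > 0\<close> t(2), of \<zeta>] that r(2)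
      by (simp add: cut_def)
    then show False using that b Compl_cuts by (auto simp: cuts_def)
  qed
  obtain y y' where y: "y \<in> ball c r" "Im ((y - b) / ?u) > 0" "y' \<in> ball c r" "Im ((y' - b) / ?u) < 0"
    using sides_near_straight_cut[OF norm_direction[OF b(1)] _ r(1), of c b] c
    unfolding cut_def by blast
  let ?H = "ball c r \<inter> {\<zeta>. Im ((\<zeta> - b) / ?u) > 0}" and ?H' = "ball c r \<inter> {\<zeta>. Im ((\<zeta> - b) / ?u) < 0}"
  have "convex ?H" "convex ?H'"
    using convex_Int[OF convex_ball convex_sides(1)] convex_Int[OF convex_ball convex_sides(2)] by blast+
  moreover have "?H \<subseteq> star" "?H' \<subseteq> star" using star by auto
  moreover have "y \<in> ?H" "y' \<in> ?H'" using y by auto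
  ultimately have H: "convex ?H" "?H \<subseteq> star" "y \<in> ?H" and H': "convex ?H'" "?H' \<subseteq> star" "y' \<in> ?H'"
    by blast+
  obtain g where g: "section_on Y f (ball c r) g" "\<forall>\<zeta>\<in>?H. g \<zeta> = s \<zeta>"
    using extend_from_convex[OF s cover H(1) Int_lower1 H(2,3)] .
  obtain h where h: "section_on Y f (ball c r) h" "\<forall>\<zeta>\<in>?H'. h \<zeta> = s \<zeta>"
    using extend_from_convex[OF s cover H'(1) Int_lower1 H'(2,3)] .
  show ?thesis by (rule that[OF r(1) sub g(1) h(1)]) (use g(2) h(2) on_cut in auto)
qed

text \<open>For \<open>c\<close> on a cut: the continuations of the star section from the two sides coincide near \<open>c\<close>.\<close>

definition extends_over :: "(complex \<Rightarrow> 'a) \<Rightarrow> complex \<Rightarrow> bool" where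
  "extends_over s c \<longleftrightarrow> (\<exists>\<rho>>0. \<exists>e. section_on Y f (ball c \<rho>) e \<and> (\<forall>\<zeta>\<in>ball c \<rho> \<inter> star. e \<zeta> = s \<zeta>))"

text \<open>Analytic continuation along the cut: on a disc around a point of the cut, the two one-sided
extensions coincide as soon as they agree at a single point, so being single-valued is an open and closed condition
on the cut without its base point, which is connected.\<close>

lemma extends_over_propagates:
  assumes s: "section_on Y f star s" and b: "b \<in> B" "b \<notin> star"
    and c: "c \<in> straight_cut (cut b) - {b}" "extends_over s c"
    and c': "c' \<in> straight_cut (cut b) - {b}"
  shows "extends_over s c'"
proof (rule connected_induction_simple[where S = "straight_cut (cut b) - {b}" and a = c])
  let ?R = "straight_cut (cut b) - {b}" and ?u = "sgn (b - z0)"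
  have "?R = (\<lambda>t. b + of_real t * ?u) ` {0<..}"
  proof (intro equalityI subsetI)
    fix x assume x: "x \<in> ?R"
    then obtain t where "t \<ge> 0" "x = b + of_real t * ?u" by (auto simp: cut_def straight_cut_def)
    then show "x \<in> (\<lambda>t. b + of_real t * ?u) ` {0<..}" using x by (cases "t = 0") auto
  qed (use b z0_notin in \<open>auto simp: cut_def straight_cut_def sgn_zero_iff intro: less_imp_le\<close>)
  moreover have "connected ((\<lambda>t::real. b + of_real t * ?u) ` {0<..})"
    by (intro connected_continuous_image continuous_intros) auto
  ultimately show "connected ?R" by simp
next
  let ?R = "straight_cut (cut b) - {b}" and ?u = "sgn (b - z0)"
  fix a assume a: "a \<in> ?R"
  obtain r g h where r: "r > 0" "ball a r \<inter> \<Union>(straight_cut ` cuts) \<subseteq> straight_cut (cut b)"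
    and gh: "section_on Y f (ball a r) g" "section_on Y f (ball a r) h"
    and g: "\<forall>\<zeta>\<in>ball a r. Im ((\<zeta> - b) / ?u) > 0 \<longrightarrow> g \<zeta> = s \<zeta>"
    and h: "\<forall>\<zeta>\<in>ball a r. Im ((\<zeta> - b) / ?u) < 0 \<longrightarrow> h \<zeta> = s \<zeta>"
    and ne: "\<forall>\<zeta>\<in>ball a r \<inter> star. Im ((\<zeta> - b) / ?u) \<noteq> 0"
    by (rule extensions_from_both_sides[OF s b a])
  have step: "extends_over s y" if x: "x \<in> ball a r \<inter> ?R" and y: "y \<in> ball a r \<inter> ?R" and P: "extends_over s x" for x y
  proof -
    obtain \<rho> e where e: "\<rho> > 0" "section_on Y f (ball x \<rho>) e" "\<And>\<zeta>. \<zeta> \<in> ball x \<rho> \<inter> star \<Longrightarrow> e \<zeta> = s \<zeta>"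
      using P unfolding extends_over_def by blast
    define \<delta> where "\<delta> = min \<rho> (r - dist a x)"
    have \<delta>: "\<delta> > 0" "\<delta> \<le> \<rho>" "\<delta> \<le> r - dist a x" using e(1) x by (auto simp: \<delta>_def)
    have sub: "ball x \<delta> \<subseteq> ball x \<rho>" "ball x \<delta> \<subseteq> ball a r"
    proof -
      show "ball x \<delta> \<subseteq> ball a r"
      proof
        fix \<zeta> assume "\<zeta> \<in> ball x \<delta>"
        then show "\<zeta> \<in> ball a r" using dist_triangle[of a \<zeta> x] \<delta>(3) by simp
      qed
    qed (use \<delta>(2) in \<open>simp add: subset_ball\<close>)
    obtain p q where p: "p \<in> ball x \<delta>" "Im ((p - b) / ?u) > 0" and q: "q \<in> ball x \<delta>" "Im ((q - b) / ?u) < 0"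
      using sides_near_straight_cut[OF norm_direction[OF b(1)] _ \<delta>(1), of x b] x unfolding cut_def by blast
    have star: "p \<in> star" "q \<in> star"
      using off_cut_in_star[OF r(2)] Im_on_straight_cut p q sub(2) unfolding cut_def by force+
    have e': "section_on Y f (ball x \<delta>) e" by (rule section_on_subset[OF e(2) sub(1)])
    have "p \<in> ball x \<rho>" "q \<in> ball x \<rho>" "p \<in> ball a r" "q \<in> ball a r"
      using p(1) q(1) sub by blast+
    then have "g p = e p" "h q = e q" using g h e(3) p(2) q(2) star by auto
    then have "g x = e x" "h x = e x"
      using section_unique[OF connected_ball section_on_subset[OF gh(1) sub(2)] e' p(1)]
        section_unique[OF connected_ball section_on_subset[OF gh(2) sub(2)] e' q(1)] \<delta>(1) by simp_all
    then have "g \<zeta> = h \<zeta>" if "\<zeta> \<in> ball a r" for \<zeta>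
      using section_unique[OF connected_ball gh, of x \<zeta>] x that by auto
    then have gs: "g \<zeta> = s \<zeta>" if "\<zeta> \<in> ball a r \<inter> star" for \<zeta>
      using g h ne that by (metis IntD1 linorder_neqE_linordered_idom)
    have "ball y (r - dist a y) \<subseteq> ball a r"
    proof
      fix \<zeta> assume "\<zeta> \<in> ball y (r - dist a y)"
      then show "\<zeta> \<in> ball a r" using dist_triangle[of a \<zeta> y] by simp
    qed
    then show ?thesis
      unfolding extends_over_def using y gs section_on_subset[OF gh(1)]
      by (intro exI[of _ "r - dist a y"] conjI exI[of _ g]) auto
  qed
  show "\<exists>T. openin (top_of_set ?R) T \<and> a \<in> T \<and> (\<forall>x\<in>T. \<forall>y\<in>T. extends_over s x \<longrightarrow> extends_over s y)"
  proof (intro exI[of _ "?R \<inter> ball a r"] conjI)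
    show "openin (top_of_set ?R) (?R \<inter> ball a r)" by (rule openin_open_Int[OF open_ball])
    show "a \<in> ?R \<inter> ball a r" using a r(1) by simp
    show "\<forall>x\<in>?R \<inter> ball a r. \<forall>y\<in>?R \<inter> ball a r. extends_over s x \<longrightarrow> extends_over s y"
      using step by blast
  qed
qed (fact c c')+

text \<open>A star section that is single-valued across the cut is single-valued on a punctured disc around the
base point, extends over the puncture, and then reaches the base point radially; but the base point of a cut is
outside the star.\<close>

lemma not_extends_over:
  assumes s: "section_on Y f star s" "s z0 = p0" and b: "b \<in> B" "b \<notin> star"
    and c: "c \<in> straight_cut (cut b) - {b}"
  shows "\<not> extends_over s c"
proof
  assume ext: "extends_over s c"
  let ?R = "straight_cut (cut b) - {b}" and ?u = "sgn (b - z0)"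
  have "\<forall>x\<in>?R. extends_over s x" using extends_over_propagates[OF s(1) b c ext] by blast
  then have "\<forall>x\<in>?R. \<exists>\<rho>. \<rho> > 0 \<and> (\<exists>e. section_on Y f (ball x \<rho>) e \<and> (\<forall>\<zeta>\<in>ball x \<rho> \<inter> star. e \<zeta> = s \<zeta>))"
    unfolding extends_over_def by blast
  then obtain \<rho> e where \<rho>: "\<And>x. x \<in> ?R \<Longrightarrow> \<rho> x > 0"
      and e: "\<And>x. x \<in> ?R \<Longrightarrow> section_on Y f (ball x (\<rho> x)) (e x)"
      and es: "\<And>x \<zeta>. x \<in> ?R \<Longrightarrow> \<zeta> \<in> ball x (\<rho> x) \<inter> star \<Longrightarrow> e x \<zeta> = s \<zeta>"
    by metis
  obtain r where r: "r > 0" "ball b r \<inter> \<Union>(straight_cut ` cuts) \<subseteq> straight_cut (cut b)"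
    using ball_missing_other_cuts[OF b(1) base_in_cut[OF b(1)]] by blast
  define s' where "s' \<zeta> = (if \<zeta> \<in> star then s \<zeta> else e \<zeta> \<zeta>)" for \<zeta>
  let ?D = "ball b r - {b}"
  have R: "\<zeta> \<in> ?R" if "\<zeta> \<in> ?D" "\<zeta> \<notin> star" for \<zeta>
    using off_cut_in_star[OF r(2)] that by blast
  have "section_on Y f ?D s'"
  proof (rule section_on_local)
    fix \<zeta> assume \<zeta>: "\<zeta> \<in> ?D"
    show "\<exists>W t. open W \<and> \<zeta> \<in> W \<and> section_on Y f (?D \<inter> W) t \<and> (\<forall>x\<in>?D \<inter> W. s' x = t x)"
    proof (cases "\<zeta> \<in> star")
      case True
      then show ?thesis
        using open_star section_on_subset[OF s(1), of "?D \<inter> star"]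
        by (intro exI[of _ star] exI[of _ s]) (auto simp: s'_def)
    next
      case False
      note \<zeta>R = R[OF \<zeta> False]
      have "s' x = e \<zeta> x" if x: "x \<in> ?D" "x \<in> ball \<zeta> (\<rho> \<zeta>)" for x
      proof (cases "x \<in> star")
        case True
        then show ?thesis using es[OF \<zeta>R] x by (simp add: s'_def)
      next
        case False
        note xR = R[OF x(1) False]
        have "open (ball \<zeta> (\<rho> \<zeta>) \<inter> ball x (\<rho> x) \<inter> ball b r)" by blast
        moreover have "x \<in> ball \<zeta> (\<rho> \<zeta>) \<inter> ball x (\<rho> x) \<inter> ball b r" using x \<rho>[OF xR] by auto
        ultimately obtain \<delta> where \<delta>: "\<delta> > 0" "ball x \<delta> \<subseteq> ball \<zeta> (\<rho> \<zeta>) \<inter> ball x (\<rho> x) \<inter> ball b r"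
          by (meson openE)
        obtain y where y: "y \<in> ball x \<delta>" "Im ((y - b) / ?u) > 0"
          using sides_near_straight_cut[OF norm_direction[OF b(1)] _ \<delta>(1), of x b] xR unfolding cut_def by blast
        have yb: "y \<in> ball x (\<rho> x)" "y \<in> ball \<zeta> (\<rho> \<zeta>)" "y \<in> ball b r" using y(1) \<delta>(2) by blast+
        have "y \<notin> straight_cut (cut b)" using Im_on_straight_cut[of y] y(2) unfolding cut_def by force
        then have ystar: "y \<in> star" by (rule off_cut_in_star[OF r(2) yb(3)])
        have "e x x = e \<zeta> x"
        proof (rule section_unique[of "ball x \<delta>" "e x" "e \<zeta>" y])
          show "section_on Y f (ball x \<delta>) (e x)" by (rule section_on_subset[OF e[OF xR]]) (use \<delta>(2) in blast)
          show "section_on Y f (ball x \<delta>) (e \<zeta>)" by (rule section_on_subset[OF e[OF \<zeta>R]]) (use \<delta>(2) in blast)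
          show "e x y = e \<zeta> y" using es[OF xR, of y] es[OF \<zeta>R, of y] yb ystar by simp
          show "connected (ball x \<delta>)" by (rule connected_ball)
          show "y \<in> ball x \<delta>" by (fact y(1))
          show "x \<in> ball x \<delta>" using \<delta>(1) by simp
        qed
        then show ?thesis using False by (simp add: s'_def)
      qed
      then show ?thesis
        using section_on_subset[OF e[OF \<zeta>R] Int_lower2, of ?D] centre_in_ball[of \<zeta> "\<rho> \<zeta>"] \<rho>[OF \<zeta>R]
        by (intro exI[of _ "ball \<zeta> (\<rho> \<zeta>)"] exI[of _ "e \<zeta>"] conjI) (blast | simp)+
    qed
  qed
  then obtain g where g: "section_on Y f (ball b r) g" "\<And>\<zeta>. \<zeta> \<in> ?D \<Longrightarrow> g \<zeta> = s' \<zeta>"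
    using puncture[OF r(1)] by blast
  have bz: "b \<noteq> z0" using b z0_notin by auto
  obtain c' where c'seg: "c' \<in> closed_segment z0 b" and c': "c' \<in> ball b r" "dist z0 c' < dist z0 b"
    using nearby_point_on_segment[OF bz r(1)] .
  then have c'D: "c' \<in> ?D" by auto
  have "c' \<in> star"
  proof (rule ccontr)
    assume "c' \<notin> star"
    then have "b \<in> closed_segment z0 c'" using R[OF c'D] mem_cut_iff[OF b(1)] by blast
    then have "dist z0 c' = dist z0 b + dist b c'" "dist z0 b = dist z0 c' + dist c' b"
      using c'seg unfolding between_mem_segment[symmetric] between by blast+
    then have "dist b c' = 0" using zero_le_dist[of b c'] unfolding dist_commute[of c' b] by linarith
    then show False using c'D by simp
  qed
  then have "b \<in> star"
    using star_step[OF s _ c'seg _ g(1)] g(2)[OF c'D] c'D by (simp add: s'_def)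
  then show False using b by blast
qed

lemma two_sided_sections:
  assumes s: "section_on Y f star s" "s z0 = p0" and b: "b \<in> B" "b \<notin> star"
    and c: "c \<in> straight_cut (cut b) - {b}"
  shows "\<exists>r>0. ball c r \<inter> \<Union>(straight_cut ` cuts) \<subseteq> straight_cut (cut b) \<and>
    (\<exists>g h. section_on Y f (ball c r) g \<and> section_on Y f (ball c r) h \<and>
      (\<forall>\<zeta>\<in>ball c r. Im ((\<zeta> - b) / sgn (b - z0)) > 0 \<longrightarrow> g \<zeta> = s \<zeta>) \<and>
      (\<forall>\<zeta>\<in>ball c r. Im ((\<zeta> - b) / sgn (b - z0)) < 0 \<longrightarrow> h \<zeta> = s \<zeta>) \<and>
      (\<exists>\<zeta>\<in>ball c r. g \<zeta> \<noteq> h \<zeta>))"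
proof -
  let ?u = "sgn (b - z0)"
  obtain r g h where r: "r > 0" "ball c r \<inter> \<Union>(straight_cut ` cuts) \<subseteq> straight_cut (cut b)"
    and gh: "section_on Y f (ball c r) g" "section_on Y f (ball c r) h"
    and g: "\<forall>\<zeta>\<in>ball c r. Im ((\<zeta> - b) / ?u) > 0 \<longrightarrow> g \<zeta> = s \<zeta>"
    and h: "\<forall>\<zeta>\<in>ball c r. Im ((\<zeta> - b) / ?u) < 0 \<longrightarrow> h \<zeta> = s \<zeta>"
    and ne: "\<forall>\<zeta>\<in>ball c r \<inter> star. Im ((\<zeta> - b) / ?u) \<noteq> 0"
    by (rule extensions_from_both_sides[OF s(1) b c])
  have "\<exists>\<zeta>\<in>ball c r. g \<zeta> \<noteq> h \<zeta>"
  proof (rule ccontr)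
    assume "\<not> (\<exists>\<zeta>\<in>ball c r. g \<zeta> \<noteq> h \<zeta>)"
    then have "g \<zeta> = s \<zeta>" if "\<zeta> \<in> ball c r \<inter> star" for \<zeta>
      using g h ne that by (metis IntD1 linorder_neqE_linordered_idom)
    then have "extends_over s c" using r(1) gh(1) unfolding extends_over_def by blast
    then show False using not_extends_over[OF s b c] by blast
  qed
  then show ?thesis using r gh g h by blast
qed

end

text \<open>Finitely many lines have empty interior.\<close>

lemma generic_point_in_ball:
  fixes B :: "complex set"
  assumes "finite B" "r > 0"
  obtains z where "z \<in> ball a r" "\<And>b b'. b \<in> B \<Longrightarrow> b' \<in> B \<Longrightarrow> z \<notin> affine hull {b, b'}"
proof -
  have "interior (\<Union>(b, b')\<in>F. affine hull {b, b'}) = {}" if "finite F" for F :: "(complex \<times> complex) set"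
    using that
  proof induction
    case (insert p F)
    obtain b b' where p: "p = (b, b')" by fastforce
    have "card {b, b'} \<le> DIM(complex)" using card_insert_le_m1[of 2 "{b'}" b] by simp
    then have "interior (affine hull {b, b'}) = {}" by (intro empty_interior_affine_hull) auto
    then show ?case
      using interior_closed_Un_empty_interior[OF closed_affine_hull insert.IH, of "{b, b'}"]
      by (simp add: p)
  qed simp
  then have "\<not> ball a r \<subseteq> (\<Union>(b, b')\<in>B \<times> B. affine hull {b, b'})"
    using assms interior_maximal[OF _ open_ball, of a r "\<Union>(b, b')\<in>B \<times> B. affine hull {b, b'}"]
    by (metis centre_in_ball finite_SigmaI subset_empty empty_iff)
  then obtain z where "z \<in> ball a r" "z \<notin> (\<Union>(b, b')\<in>B \<times> B. affine hull {b, b'})" by blast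
  then show ?thesis by (intro that) auto
qed

text \<open>With \<open>z0\<close> in the disc of a local section through \<open>p\<close>, the disc is star-shaped about \<open>z0\<close> and
therefore part of the star; so \<open>p\<close> is reached even if \<open>f p\<close> is in \<open>B\<close>.\<close>

theorem (in branched_projection) log_chart_section:
  assumes p: "p \<in> topspace Y"
  shows "\<exists>K s. cut_system K \<and> section_on Y f (- \<Union>(straight_cut ` K)) s \<and> p \<in> s ` (- \<Union>(straight_cut ` K)) \<and>
    (\<forall>(a, u)\<in>K. \<forall>c\<in>straight_cut (a, u) - {a}.
      \<exists>r>0. ball c r \<inter> \<Union>(straight_cut ` K) \<subseteq> straight_cut (a, u) \<and>
        (\<exists>g h. section_on Y f (ball c r) g \<and> section_on Y f (ball c r) h \<and>
          (\<forall>\<zeta>\<in>ball c r. Im ((\<zeta> - a) / u) > 0 \<longrightarrow> g \<zeta> = s \<zeta>) \<and>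
          (\<forall>\<zeta>\<in>ball c r. Im ((\<zeta> - a) / u) < 0 \<longrightarrow> h \<zeta> = s \<zeta>) \<and>
          (\<exists>\<zeta>\<in>ball c r. g \<zeta> \<noteq> h \<zeta>)))"
proof -
  obtain r t where r: "r > 0" and t: "section_on Y f (ball (f p) r) t" "t (f p) = p"
    using local_section[OF p] by blast
  obtain z0 where z0: "z0 \<in> ball (f p) r"
      and gen: "\<And>b b'. b \<in> B \<Longrightarrow> b' \<in> B \<Longrightarrow> z0 \<notin> affine hull {b, b'}"
    using generic_point_in_ball[OF finite_branch_values r] by blast
  interpret star_base Y f B z0 "t z0"
    using gen section_onD(2,3)[OF t(1) z0] by unfold_locales auto
  have "star_shaped (ball (f p) r)"
    unfolding star_shaped_def using z0 closed_segment_subset[OF z0 _ convex_ball] by blast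
  then have sub: "ball (f p) r \<subseteq> star" using subset_star[OF open_ball _ t(1)] by blast
  obtain s where s: "section_on Y f star s" "s z0 = t z0" using star_section by blast
  have "f p \<in> ball (f p) r" using r by simp
  then have "s (f p) = p"
    using section_unique[OF connected_ball section_on_subset[OF s(1) sub] t(1) z0 s(2)] t(2) by simp
  then have "p \<in> s ` star" using sub \<open>f p \<in> ball (f p) r\<close> by (metis image_eqI subsetD)
  moreover have "\<forall>(a, u)\<in>cuts. \<forall>c\<in>straight_cut (a, u) - {a}.
      \<exists>r>0. ball c r \<inter> \<Union>(straight_cut ` cuts) \<subseteq> straight_cut (a, u) \<and>
        (\<exists>g h. section_on Y f (ball c r) g \<and> section_on Y f (ball c r) h \<and>
          (\<forall>\<zeta>\<in>ball c r. Im ((\<zeta> - a) / u) > 0 \<longrightarrow> g \<zeta> = s \<zeta>) \<and>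
          (\<forall>\<zeta>\<in>ball c r. Im ((\<zeta> - a) / u) < 0 \<longrightarrow> h \<zeta> = s \<zeta>) \<and>
          (\<exists>\<zeta>\<in>ball c r. g \<zeta> \<noteq> h \<zeta>))"
  proof (rule ballI, unfold split_beta, rule ballI)
    fix k c assume "k \<in> cuts" and c: "c \<in> straight_cut (fst k, snd k) - {fst k}"
    then obtain b where b: "b \<in> B" "b \<notin> star" and k: "k = cut b" by (auto simp: cuts_def)
    show "\<exists>r>0. ball c r \<inter> \<Union>(straight_cut ` cuts) \<subseteq> straight_cut (fst k, snd k) \<and>
        (\<exists>g h. section_on Y f (ball c r) g \<and> section_on Y f (ball c r) h \<and>
          (\<forall>\<zeta>\<in>ball c r. Im ((\<zeta> - fst k) / snd k) > 0 \<longrightarrow> g \<zeta> = s \<zeta>) \<and>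
          (\<forall>\<zeta>\<in>ball c r. Im ((\<zeta> - fst k) / snd k) < 0 \<longrightarrow> h \<zeta> = s \<zeta>) \<and>
          (\<exists>\<zeta>\<in>ball c r. g \<zeta> \<noteq> h \<zeta>))"
      using two_sided_sections[OF s b] c unfolding k cut_def fst_conv snd_conv .
  qed
  ultimately show ?thesis
    using cut_system_cuts s(1) by (intro exI[of _ cuts] exI[of _ s]) (simp only: Compl_cuts simp_thms)
qed

section \<open>Meromorphic functions on a compact Riemann surface\<close>

text \<open>Bolzano-Weierstrass in contrapositive form; it yields finiteness of fibres and of the set of
exceptional points.\<close>

lemma finite_by_isolation:
  assumes "compact_space X" "Q \<subseteq> topspace X"
    and "\<And>x. x \<in> topspace X \<Longrightarrow> \<exists>N. openin X N \<and> x \<in> N \<and> N \<inter> Q \<subseteq> {x}"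
  shows "finite Q"
proof (rule ccontr)
  assume "infinite Q"
  then obtain x where "x \<in> X derived_set_of Q"
    using compact_space_imp_Bolzano_Weierstrass assms(1,2) by blast
  then show False using assms(3)[of x] unfolding in_derived_set_of by blast
qed

lemma
  assumes "complex_chart X (U, \<phi>)"
  shows complex_chart_domain_open: "openin X U"
    and complex_chart_inj: "inj_on \<phi> U"
    and complex_chart_open_image: "openin X W \<Longrightarrow> W \<subseteq> U \<Longrightarrow> open (\<phi> ` W)"
    and complex_chart_open_preimage: "open V \<Longrightarrow> openin X {q \<in> U. \<phi> q \<in> V}"
    and complex_chart_inverse_continuous: "continuous_map (top_of_set (\<phi> ` U)) X (inv_into U \<phi>)"
proof -
  have U: "openin X U" and \<phi>U: "open (\<phi> ` U)"
    and hom: "homeomorphic_map (subtopology X U) (top_of_set (\<phi> ` U)) \<phi>"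
    using assms by (auto simp: complex_chart_def)
  have top: "topspace (subtopology X U) = U" using openin_subset[OF U] by auto
  show "openin X U" by (fact U)
  show inj: "inj_on \<phi> U" using homeomorphic_imp_injective_map[OF hom] top by simp
  show "open (\<phi> ` W)" if "openin X W" "W \<subseteq> U"
  proof -
    have "openin (subtopology X U) W" using that U openin_open_subtopology by blast
    then have "openin (top_of_set (\<phi> ` U)) (\<phi> ` W)"
      using homeomorphic_imp_open_map[OF hom] unfolding open_map_def by blast
    then show ?thesis using \<phi>U openin_open_eq by blast
  qed
  show "openin X {q \<in> U. \<phi> q \<in> V}" if "open V"
  proof -
    have "openin (top_of_set (\<phi> ` U)) (\<phi> ` U \<inter> V)" using that by (rule openin_open_Int)
    then have "openin (subtopology X U) {q \<in> topspace (subtopology X U). \<phi> q \<in> \<phi> ` U \<inter> V}"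
      using homeomorphic_imp_continuous_map[OF hom] openin_continuous_map_preimage by blast
    moreover have "{q \<in> topspace (subtopology X U). \<phi> q \<in> \<phi> ` U \<inter> V} = {q \<in> U. \<phi> q \<in> V}"
      unfolding top by blast
    ultimately show ?thesis using U openin_open_subtopology by metis
  qed
  show "continuous_map (top_of_set (\<phi> ` U)) X (inv_into U \<phi>)"
  proof -
    obtain g where g: "homeomorphic_maps (subtopology X U) (top_of_set (\<phi> ` U)) \<phi> g"
      using hom homeomorphic_map_maps by blast
    then have g': "continuous_map (top_of_set (\<phi> ` U)) (subtopology X U) g" "\<And>x. x \<in> U \<Longrightarrow> g (\<phi> x) = x"
      unfolding homeomorphic_maps_def top by auto
    have "continuous_map (top_of_set (\<phi> ` U)) X g"
      using g'(1) by (rule continuous_map_into_fulltopology)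
    then show ?thesis
      by (rule continuous_map_eq) (auto simp: g' inj)
  qed
qed

lemma chart_eventually:
  assumes c: "complex_chart X (U, \<phi>)" and x: "x \<in> U" and ev: "eventually P (at (\<phi> x))"
  obtains N where "openin X N" "x \<in> N" "N \<subseteq> U" "\<forall>q\<in>N - {x}. P (\<phi> q)"
proof -
  obtain T where T: "open T" "\<phi> x \<in> T" "\<forall>y\<in>T. y \<noteq> \<phi> x \<longrightarrow> P y"
    using ev unfolding eventually_at_topological by blast
  show ?thesis
  proof (rule that[of "{q \<in> U. \<phi> q \<in> T}"])
    show "openin X {q \<in> U. \<phi> q \<in> T}" by (rule complex_chart_open_preimage[OF c T(1)])
    show "\<forall>q\<in>{q \<in> U. \<phi> q \<in> T} - {x}. P (\<phi> q)"
      using T(3) inj_onD[OF complex_chart_inj[OF c]] x by blast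
  qed (use x T in auto)
qed

text \<open>The local identity theorem at a point that may be a pole.\<close>

lemma meromorphic_eq_or_neq:
  assumes "f meromorphic_on {x}"
  shows "eventually (\<lambda>y. f y = b) (at x) \<or> eventually (\<lambda>y. f y \<noteq> b) (at x)"
proof -
  have "(\<lambda>y. f y - b) meromorphic_on {x}" using assms by (intro meromorphic_intros)
  then have "isolated_singularity_at (\<lambda>y. f y - b) x" "not_essential (\<lambda>y. f y - b) x"
    by (auto simp: meromorphic_at_iff)
  then show ?thesis
    using not_essential_frequently_0_imp_eventually_0[of "\<lambda>y. f y - b" x]
    by (auto simp: frequently_def)
qed

text \<open>Infinitely many values is the form of nonconstancy that survives the
convention for values at poles and is directly available for curves.\<close>

locale compact_surface_function =
  fixes X :: "'a topology" and A :: "'a chart set" and z :: "'a \<Rightarrow> complex"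
  assumes surface: "riemann_surface X A"
    and compact: "compact_space X"
    and meromorphic: "meromorphic_fun A z"
    and nonconstant: "infinite (z ` topspace X)"
begin

definition S where "S = topspace X - (poles A z \<union> ramification_points X z)"

lemma chart: "(U, \<phi>) \<in> A \<Longrightarrow> complex_chart X (U, \<phi>)"
  using surface unfolding riemann_surface_def by blast

lemma chart_at:
  assumes "x \<in> topspace X"
  obtains U \<phi> where "(U, \<phi>) \<in> A" "x \<in> U"
  using surface assms unfolding riemann_surface_def by blast

lemma hausdorff_X: "Hausdorff_space X"
  using surface unfolding riemann_surface_def by blast

lemma in_chart_image: "(U, \<phi>) \<in> A \<Longrightarrow> x \<in> U \<Longrightarrow> inv_into U \<phi> (\<phi> x) = x"
  using complex_chart_inj[OF chart] by simp

lemma meromorphic_at: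
  assumes "(U, \<phi>) \<in> A" "x \<in> U"
  shows "(z \<circ> inv_into U \<phi>) meromorphic_on {\<phi> x}"
proof -
  have "(z \<circ> inv_into U \<phi>) meromorphic_on \<phi> ` U"
    using meromorphic assms(1) unfolding meromorphic_fun_def nicely_meromorphic_on_def by blast
  then show ?thesis by (rule meromorphic_on_subset) (use assms in auto)
qed

lemma no_isolated_points:
  assumes "openin X N" "x \<in> N"
  shows "N \<noteq> {x}"
proof
  assume N: "N = {x}"
  obtain U \<phi> where U: "(U, \<phi>) \<in> A" "x \<in> U" using chart_at openin_subset[OF assms(1)] assms(2) by blast
  then have "open (\<phi> ` {x})" using complex_chart_open_image[OF chart[OF U(1)]] assms(1) N by blast
  then show False using not_open_singleton by auto
qed

lemma open_delete_point:
  assumes "openin X N"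
  shows "openin X (N - {x})"
proof (cases "x \<in> topspace X")
  case True
  then have "closedin X {x}"
    using Hausdorff_imp_t1_space[OF hausdorff_X] by (simp add: t1_space_closedin_singleton)
  then show ?thesis using assms by (rule openin_diff[rotated])
next
  case False
  then show ?thesis using assms openin_subset[OF assms] by (metis Diff_insert0 Diff_empty subsetD)
qed

text \<open>The global identity theorem. The points near which \<open>z\<close> is \<open>b\<close> and those near which \<open>z\<close> avoids
\<open>b\<close> form two disjoint open sets covering the connected space \<open>X\<close>; if the first were everything, compactness would
leave only finitely many values.\<close>

lemma nowhere_locally_constant:
  assumes x: "x \<in> topspace X"
  shows "\<exists>N. openin X N \<and> x \<in> N \<and> (\<forall>q\<in>N - {x}. z q \<noteq> b)"
proof -
  define C where "C = {x \<in> topspace X. \<exists>N. openin X N \<and> x \<in> N \<and> (\<forall>q\<in>N - {x}. z q = b)}"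
  define D where "D = {x \<in> topspace X. \<exists>N. openin X N \<and> x \<in> N \<and> (\<forall>q\<in>N - {x}. z q \<noteq> b)}"
  have "topspace X \<subseteq> C \<union> D"
  proof
    fix y assume y: "y \<in> topspace X"
    then obtain U \<phi> where U: "(U, \<phi>) \<in> A" "y \<in> U" by (rule chart_at)
    let ?F = "z \<circ> inv_into U \<phi>"
    have F: "?F (\<phi> q) = z q" if "q \<in> U" for q using in_chart_image[OF U(1) that] by simp
    consider "eventually (\<lambda>\<zeta>. ?F \<zeta> = b) (at (\<phi> y))" | "eventually (\<lambda>\<zeta>. ?F \<zeta> \<noteq> b) (at (\<phi> y))"
      using meromorphic_eq_or_neq[OF meromorphic_at[OF U]] by blast
    then show "y \<in> C \<union> D"
    proof cases
      case 1
      then obtain N where "openin X N" "y \<in> N" "N \<subseteq> U" "\<forall>q\<in>N - {y}. ?F (\<phi> q) = b"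
        using chart_eventually[OF chart[OF U(1)] U(2)] by blast
      then have "\<forall>q\<in>N - {y}. z q = b" using F by (metis DiffD1 subsetD)
      then show ?thesis using \<open>openin X N\<close> \<open>y \<in> N\<close> y unfolding C_def by blast
    next
      case 2
      then obtain N where "openin X N" "y \<in> N" "N \<subseteq> U" "\<forall>q\<in>N - {y}. ?F (\<phi> q) \<noteq> b"
        using chart_eventually[OF chart[OF U(1)] U(2)] by blast
      then have "\<forall>q\<in>N - {y}. z q \<noteq> b" using F by (metis DiffD1 subsetD)
      then show ?thesis using \<open>openin X N\<close> \<open>y \<in> N\<close> y unfolding D_def by blast
    qed
  qed
  moreover have "openin X C" "openin X D"
  proof -
    have "openin X {x \<in> topspace X. \<exists>N. openin X N \<and> x \<in> N \<and> (\<forall>q\<in>N - {x}. R q)}" (is "openin X ?T") for R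
    proof (subst openin_subopen, intro ballI)
      fix y assume "y \<in> ?T"
      then obtain N where N: "openin X N" "y \<in> N" "\<forall>q\<in>N - {y}. R q" by blast
      have "N \<subseteq> ?T"
      proof
        fix q assume q: "q \<in> N"
        show "q \<in> ?T"
        proof (cases "q = y")
          case False
          have "openin X (N - {y})" by (rule open_delete_point[OF N(1)])
          then show ?thesis using False q N openin_subset[OF N(1)] by blast
        qed (use N q openin_subset in blast)
      qed
      then show "\<exists>T. openin X T \<and> y \<in> T \<and> T \<subseteq> ?T" using N by blast
    qed
    from this[of "\<lambda>q. z q = b"] this[of "\<lambda>q. z q \<noteq> b"] show "openin X C" "openin X D"
      unfolding C_def D_def by simp_all
  qed
  moreover have "C \<inter> D = {}"
  proof (rule ccontr)
    assume "C \<inter> D \<noteq> {}"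
    then obtain y N N' where "openin X N" "y \<in> N" "\<forall>q\<in>N - {y}. z q = b"
        "openin X N'" "y \<in> N'" "\<forall>q\<in>N' - {y}. z q \<noteq> b"
      unfolding C_def D_def by blast
    then have "openin X (N \<inter> N')" "y \<in> N \<inter> N'" "N \<inter> N' = {y}" by auto
    then show False using no_isolated_points by blast
  qed
  moreover have "C \<subseteq> topspace X" "D \<subseteq> topspace X" by (auto simp: C_def D_def)
  ultimately have "C = {} \<or> D = {}"
    using surface unfolding riemann_surface_def connected_space_def by blast
  moreover have "D \<noteq> {}"
  proof
    assume "D = {}"
    then have C: "C = topspace X" using \<open>topspace X \<subseteq> C \<union> D\<close> \<open>C \<subseteq> topspace X\<close> by blast
    have "finite {q \<in> topspace X. z q \<noteq> b}"
    proof (rule finite_by_isolation[OF compact])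
      fix y assume "y \<in> topspace X"
      then obtain N where "openin X N" "y \<in> N" "\<forall>q\<in>N - {y}. z q = b" using C unfolding C_def by blast
      then show "\<exists>N. openin X N \<and> y \<in> N \<and> N \<inter> {q \<in> topspace X. z q \<noteq> b} \<subseteq> {y}" by blast
    qed auto
    moreover have "z ` topspace X \<subseteq> insert b (z ` {q \<in> topspace X. z q \<noteq> b})" by blast
    ultimately show False using nonconstant finite_subset by blast
  qed
  ultimately have "x \<in> D" using x \<open>topspace X \<subseteq> C \<union> D\<close> by blast
  then show ?thesis unfolding D_def by blast
qed

lemma pole_nhd:
  assumes "x \<in> poles A z"
  obtains N where "openin X N" "x \<in> N" "\<forall>q\<in>N - {x}. R < norm (z q)"
proof -
  obtain U \<phi> where U: "(U, \<phi>) \<in> A" "x \<in> U" and pole: "is_pole (z \<circ> inv_into U \<phi>) (\<phi> x)"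
    using assms unfolding poles_def by blast
  have "eventually (\<lambda>\<zeta>. R < norm ((z \<circ> inv_into U \<phi>) \<zeta>)) (at (\<phi> x))"
    using pole unfolding is_pole_def by (simp add: filterlim_at_infinity_conv_norm_at_top filterlim_at_top_dense)
  then obtain N where N: "openin X N" "x \<in> N" "N \<subseteq> U" "\<forall>q\<in>N - {x}. R < norm ((z \<circ> inv_into U \<phi>) (\<phi> q))"
    by (rule chart_eventually[OF chart[OF U(1)] U(2)])
  show ?thesis
  proof (rule that[OF N(1,2)], rule ballI)
    fix q assume q: "q \<in> N - {x}"
    then have "q \<in> U" using N(3) by blast
    then show "R < norm (z q)" using N(4) q in_chart_image[OF U(1)] by force
  qed
qed

lemma analytic_nhd:
  assumes U: "(U, \<phi>) \<in> A" "x \<in> U" and an: "(z \<circ> inv_into U \<phi>) analytic_on {\<phi> x}"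
  obtains e where "e > 0" "ball (\<phi> x) e \<subseteq> \<phi> ` U" "(z \<circ> inv_into U \<phi>) holomorphic_on ball (\<phi> x) e"
proof -
  obtain e where e: "e > 0" "(z \<circ> inv_into U \<phi>) holomorphic_on ball (\<phi> x) e"
    using an unfolding analytic_on_def by blast
  have "open (\<phi> ` U)" using complex_chart_open_image[OF chart[OF U(1)]] complex_chart_domain_open[OF chart[OF U(1)]] by blast
  then obtain e' where e': "e' > 0" "ball (\<phi> x) e' \<subseteq> \<phi> ` U" using U(2) by (meson imageI openE)
  show ?thesis
  proof (rule that[of "min e e'"])
    show "(z \<circ> inv_into U \<phi>) holomorphic_on ball (\<phi> x) (min e e')"
      by (rule holomorphic_on_subset[OF e(2)]) auto
  qed (use e e' in auto)
qed

lemma not_pole_analytic: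
  assumes "(U, \<phi>) \<in> A" "x \<in> U" "x \<notin> poles A z"
  shows "(z \<circ> inv_into U \<phi>) analytic_on {\<phi> x}"
proof (rule nicely_meromorphic_on_imp_analytic_at)
  show "(z \<circ> inv_into U \<phi>) nicely_meromorphic_on \<phi> ` U"
    using meromorphic assms(1) unfolding meromorphic_fun_def by blast
  show "\<not> is_pole (z \<circ> inv_into U \<phi>) (\<phi> x)" using assms unfolding poles_def by blast
qed (use assms in blast)

lemma continuous_nhd:
  assumes U: "(U, \<phi>) \<in> A" "x \<in> U" and an: "(z \<circ> inv_into U \<phi>) analytic_on {\<phi> x}"
    and V: "open V" "z x \<in> V"
  obtains N where "openin X N" "x \<in> N" "z ` N \<subseteq> V"
proof -
  let ?F = "z \<circ> inv_into U \<phi>"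
  obtain e where e: "e > 0" "ball (\<phi> x) e \<subseteq> \<phi> ` U" "?F holomorphic_on ball (\<phi> x) e"
    using analytic_nhd[OF U an] .
  have "open (ball (\<phi> x) e \<inter> ?F -` V)"
    using continuous_open_preimage[OF holomorphic_on_imp_continuous_on[OF e(3)] open_ball V(1)] .
  then have "openin X {q \<in> U. \<phi> q \<in> ball (\<phi> x) e \<inter> ?F -` V}"
    by (rule complex_chart_open_preimage[OF chart[OF U(1)]])
  moreover have "x \<in> {q \<in> U. \<phi> q \<in> ball (\<phi> x) e \<inter> ?F -` V}"
    using U V(2) e(1) in_chart_image[OF U] by simp
  moreover have "z ` {q \<in> U. \<phi> q \<in> ball (\<phi> x) e \<inter> ?F -` V} \<subseteq> V"
    using in_chart_image[OF U(1)] by auto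
  ultimately show ?thesis by (rule that)
qed

text \<open>Being a pole does not depend on the chart: near a pole \<open>z\<close> is unbounded, near a point where it is
analytic in some chart it is bounded.\<close>

lemma analytic_not_pole:
  assumes U: "(U, \<phi>) \<in> A" "x \<in> U" and an: "(z \<circ> inv_into U \<phi>) analytic_on {\<phi> x}"
  shows "x \<notin> poles A z"
proof
  assume "x \<in> poles A z"
  then obtain N where N: "openin X N" "x \<in> N" "\<forall>q\<in>N - {x}. norm (z x) + 1 < norm (z q)"
    by (rule pole_nhd)
  obtain N' where N': "openin X N'" "x \<in> N'" "z ` N' \<subseteq> ball (z x) 1"
    using continuous_nhd[OF U an, of "ball (z x) 1"] by auto
  have "N \<inter> N' \<noteq> {x}" using no_isolated_points[of "N \<inter> N'"] N N' by blast
  then obtain q where q: "q \<in> N - {x}" "q \<in> N'" using N N' by blast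
  then have "norm (z q - z x) < 1" using N'(3) by (auto simp: dist_norm norm_minus_commute)
  then show False using N(3)[rule_format, OF q(1)] norm_triangle_ineq[of "z q - z x" "z x"] by simp
qed

lemma not_ramified:
  assumes U: "(U, \<phi>) \<in> A" "x \<in> U" and V: "open V" "\<phi> x \<in> V" "inj_on (z \<circ> inv_into U \<phi>) V"
  shows "x \<notin> ramification_points X z"
proof -
  let ?N = "{q \<in> U. \<phi> q \<in> V}"
  have "openin X ?N" by (rule complex_chart_open_preimage[OF chart[OF U(1)] V(1)])
  moreover have "inj_on z ?N"
  proof (rule inj_onI)
    fix p q assume pq: "p \<in> ?N" "q \<in> ?N" "z p = z q"
    have "(z \<circ> inv_into U \<phi>) (\<phi> p) = (z \<circ> inv_into U \<phi>) (\<phi> q)"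
      using pq in_chart_image[OF U(1), of p] in_chart_image[OF U(1), of q] by simp
    then have "\<phi> p = \<phi> q" by (rule inj_onD[OF V(3)]) (use pq in auto)
    then show "p = q" by (rule inj_onD[OF complex_chart_inj[OF chart[OF U(1)]]]) (use pq in auto)
  qed
  ultimately show ?thesis using U(2) V(2) unfolding ramification_points_def by blast
qed

text \<open>In a chart the derivative of \<open>z\<close> is meromorphic and not locally zero, hence nonzero
near each point with the possible exception of the point itself; where it is nonzero, \<open>z\<close> is locally injective.\<close>

lemma isolated_exceptional_point:
  assumes x: "x \<in> topspace X"
  shows "\<exists>N. openin X N \<and> x \<in> N \<and> N \<inter> (poles A z \<union> ramification_points X z) \<subseteq> {x}"
proof -
  obtain U \<phi> where U: "(U, \<phi>) \<in> A" "x \<in> U" using chart_at x by blast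
  let ?F = "z \<circ> inv_into U \<phi>"
  have mero: "?F meromorphic_on {\<phi> x}" by (rule meromorphic_at[OF U])
  then have ev_an: "eventually (\<lambda>\<zeta>. ?F analytic_on {\<zeta>}) (at (\<phi> x))"
    by (simp add: meromorphic_at_iff isolated_singularity_at_altdef)
  have "deriv ?F meromorphic_on {\<phi> x}" using mero by (intro meromorphic_intros)
  then consider "eventually (\<lambda>\<zeta>. deriv ?F \<zeta> = 0) (at (\<phi> x))" | "eventually (\<lambda>\<zeta>. deriv ?F \<zeta> \<noteq> 0) (at (\<phi> x))"
    using meromorphic_eq_or_neq by blast
  then show ?thesis
  proof cases
    case 1
    have "eventually (\<lambda>\<zeta>. (?F has_field_derivative 0) (at \<zeta>)) (at (\<phi> x))"
      using 1 ev_an by eventually_elim (metis analytic_on_imp_differentiable_at field_differentiable_derivI singletonI)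
    then obtain N where N: "openin X N" "x \<in> N" "N \<subseteq> U" "\<forall>q\<in>N - {x}. (?F has_field_derivative 0) (at (\<phi> q))"
      by (rule chart_eventually[OF chart[OF U(1)] U(2)])
    obtain q where q: "q \<in> N - {x}" using no_isolated_points[OF N(1,2)] N(2) by blast
    have "open (\<phi> ` (N - {x}))"
      using complex_chart_open_image[OF chart[OF U(1)] open_delete_point[OF N(1)]] N(3) by blast
    then obtain e where e: "e > 0" "ball (\<phi> q) e \<subseteq> \<phi> ` (N - {x})" using q by (meson imageI openE)
    have "(?F has_field_derivative 0) (at y within ball (\<phi> q) e)" if "y \<in> ball (\<phi> q) e" for y
    proof -
      have "y \<in> \<phi> ` (N - {x})" using e(2) that by (rule subsetD)
      then show ?thesis using N(4) has_field_derivative_at_within by blast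
    qed
    then have "\<exists>c. \<forall>y\<in>ball (\<phi> q) e. ?F y = c" by (rule has_field_derivative_zero_constant[OF convex_ball])
    then obtain c where c: "\<forall>y\<in>ball (\<phi> q) e. ?F y = c" by blast
    have "q \<in> topspace X" using q openin_subset[OF N(1)] by blast
    then obtain N' where N': "openin X N'" "q \<in> N'" "\<forall>p\<in>N' - {q}. z p \<noteq> c" using nowhere_locally_constant by blast
    have "openin X (N' \<inter> {p \<in> U. \<phi> p \<in> ball (\<phi> q) e})"
      by (intro openin_Int N'(1) complex_chart_open_preimage[OF chart[OF U(1)] open_ball])
    then have "N' \<inter> {p \<in> U. \<phi> p \<in> ball (\<phi> q) e} \<noteq> {q}"
      using no_isolated_points[of _ q] q N(3) N'(2) e(1) by auto
    moreover have "q \<in> N' \<inter> {p \<in> U. \<phi> p \<in> ball (\<phi> q) e}" using q N(3) N'(2) e(1) by auto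
    ultimately obtain p where p: "p \<in> N' - {q}" "p \<in> U" "\<phi> p \<in> ball (\<phi> q) e" by blast
    then have "z p = c" using bspec[OF c p(3)] in_chart_image[OF U(1) p(2)] by simp
    then show ?thesis using N'(3) p(1) by blast
  next
    case 2
    have "eventually (\<lambda>\<zeta>. deriv ?F \<zeta> \<noteq> 0 \<and> ?F analytic_on {\<zeta>}) (at (\<phi> x))"
      using 2 ev_an by eventually_elim blast
    then obtain N where N: "openin X N" "x \<in> N" "N \<subseteq> U"
        "\<forall>q\<in>N - {x}. deriv ?F (\<phi> q) \<noteq> 0 \<and> ?F analytic_on {\<phi> q}"
      by (rule chart_eventually[OF chart[OF U(1)] U(2)])
    have "q \<notin> poles A z \<union> ramification_points X z" if q: "q \<in> N - {x}" for q
    proof -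
      have qU: "q \<in> U" and dq: "deriv ?F (\<phi> q) \<noteq> 0" and an: "?F analytic_on {\<phi> q}" using q N(3,4) by auto
      obtain e where e: "e > 0" "ball (\<phi> q) e \<subseteq> \<phi> ` U" "?F holomorphic_on ball (\<phi> q) e"
        using analytic_nhd[OF U(1) qU an] .
      obtain r where r: "r > 0" "inj_on ?F (ball (\<phi> q) r)"
        using has_complex_derivative_locally_injective[OF e(3) _ open_ball dq] e(1) by auto
      show ?thesis
        using analytic_not_pole[OF U(1) qU an] not_ramified[OF U(1) qU open_ball _ r(2)] r(1) by simp
    qed
    then show ?thesis using N by blast
  qed
qed

lemma exceptional_subset: "poles A z \<union> ramification_points X z \<subseteq> topspace X"
  using complex_chart_domain_open[OF chart] openin_subset
  unfolding poles_def ramification_points_def by blast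

lemma finite_exceptional: "finite (poles A z \<union> ramification_points X z)"
  using isolated_exceptional_point exceptional_subset by (intro finite_by_isolation[OF compact])

lemma finite_fibre: "finite {q \<in> topspace X. z q = b}"
proof (rule finite_by_isolation[OF compact])
  fix x assume "x \<in> topspace X"
  then obtain N where "openin X N" "x \<in> N" "\<forall>q\<in>N - {x}. z q \<noteq> b"
    using nowhere_locally_constant by blast
  then show "\<exists>N. openin X N \<and> x \<in> N \<and> N \<inter> {q \<in> topspace X. z q = b} \<subseteq> {x}" by blast
qed auto

section \<open>The complement of the poles and ramification points\<close>

lemma S_subset: "S \<subseteq> topspace X"
  by (auto simp: S_def)

lemma topspace_Y: "topspace (subtopology X S) = S"
  using S_subset by auto

lemma open_S: "openin X S"
proof -
  have "closedin X (poles A z \<union> ramification_points X z)"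
    using Hausdorff_imp_t1_space[OF hausdorff_X] exceptional_subset finite_exceptional
    unfolding t1_space_closedin_finite by blast
  then show ?thesis unfolding S_def by (rule openin_diff[OF openin_topspace])
qed

text \<open>A punctured disc around \<open>p\<close> is connected, so it lies on one side of any separation of
\<open>C - {p}\<close>; adding the disc to that side would separate \<open>C\<close>.\<close>

lemma connectedin_delete_point:
  assumes C: "connectedin X C" "openin X C"
  shows "connectedin X (C - {p})"
proof (cases "p \<in> C")
  case True
  then obtain U \<phi> where U: "(U, \<phi>) \<in> A" "p \<in> U" using chart_at openin_subset[OF C(2)] by blast
  note ch = chart[OF U(1)]
  have "open (\<phi> ` (U \<inter> C))"
    using complex_chart_open_image[OF ch openin_Int[OF complex_chart_domain_open[OF ch] C(2)]] by blast
  then obtain e where e: "e > 0" "ball (\<phi> p) e \<subseteq> \<phi> ` (U \<inter> C)" using U(2) True by (meson IntI imageI openE)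
  let ?N = "{q \<in> U. \<phi> q \<in> ball (\<phi> p) e}"
  have N: "openin X ?N" by (rule complex_chart_open_preimage[OF ch open_ball])
  have img: "inv_into U \<phi> ` (ball (\<phi> p) e - {\<phi> p}) = ?N - {p}"
  proof (intro equalityI subsetI)
    fix q assume "q \<in> inv_into U \<phi> ` (ball (\<phi> p) e - {\<phi> p})"
    then obtain y where y: "y \<in> ball (\<phi> p) e" "y \<noteq> \<phi> p" "q = inv_into U \<phi> y" by blast
    then have "y \<in> \<phi> ` U" using e(2) by blast
    then have "q \<in> U" "\<phi> q = y" using y(3) by (simp_all add: inv_into_into f_inv_into_f)
    then show "q \<in> ?N - {p}" using y by auto
  next
    fix q assume q: "q \<in> ?N - {p}"
    then have "\<phi> q \<noteq> \<phi> p" using inj_onD[OF complex_chart_inj[OF ch]] U(2) by blast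
    then have "\<phi> q \<in> ball (\<phi> p) e - {\<phi> p}" "q = inv_into U \<phi> (\<phi> q)"
      using q in_chart_image[OF U(1)] by auto
    then show "q \<in> inv_into U \<phi> ` (ball (\<phi> p) e - {\<phi> p})" by blast
  qed
  have "connectedin X (?N - {p})"
    unfolding img[symmetric]
  proof (rule connectedin_continuous_map_image[OF complex_chart_inverse_continuous[OF ch]])
    show "connectedin (top_of_set (\<phi> ` U)) (ball (\<phi> p) e - {\<phi> p})"
      using e(2) connected_punctured_ball[of "\<phi> p" e] by (auto simp: connectedin_subtopology)
  qed
  then have Nconn: "E \<inter> (?N - {p}) = {} \<or> E' \<inter> (?N - {p}) = {}"
    if "openin X E" "openin X E'" "?N - {p} \<subseteq> E \<union> E'" "E \<inter> E' = {}" for E E'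
    using that unfolding connectedin by blast
  have NC: "?N \<subseteq> C"
  proof
    fix q assume q: "q \<in> ?N"
    then obtain q' where "q' \<in> U \<inter> C" "\<phi> q' = \<phi> q" using e(2) by (metis (mono_tags, lifting) imageE mem_Collect_eq subsetD)
    then show "q \<in> C" using q inj_onD[OF complex_chart_inj[OF ch], of q' q] by auto
  qed
  have pN: "p \<in> ?N" using U(2) e(1) by simp
  have False if E: "openin X E" "openin X E'" "C - {p} \<subseteq> E \<union> E'" "E \<inter> E' \<inter> (C - {p}) = {}"
      "E \<inter> (C - {p}) \<noteq> {}" "E' \<inter> (C - {p}) \<noteq> {}" "E' \<inter> (?N - {p}) = {}" for E E'
  proof -
    let ?G = "(E \<inter> (C - {p})) \<union> ?N" and ?G' = "E' \<inter> (C - {p})"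
    have "openin X ?G" "openin X ?G'"
      using E(1,2) N open_delete_point[OF C(2)] by (auto intro: openin_Int openin_Un)
    moreover have "C \<subseteq> ?G \<union> ?G'" using E(3) pN by blast
    moreover have "?G \<inter> ?G' \<inter> C = {}" using E(4,7) by blast
    moreover have "?G \<inter> C \<noteq> {}" "?G' \<inter> C \<noteq> {}" using E(5,6) by blast+
    ultimately show False using C(1) unfolding connectedin by blast
  qed
  note sep = this
  have "C - {p} \<subseteq> topspace X" using openin_subset[OF C(2)] by blast
  moreover have False if E: "openin X E" "openin X E'" "C - {p} \<subseteq> E \<union> E'" "E \<inter> E' \<inter> (C - {p}) = {}"
      "E \<inter> (C - {p}) \<noteq> {}" "E' \<inter> (C - {p}) \<noteq> {}" for E E'
  proof -
    have "openin X (E \<inter> (C - {p}))" "openin X (E' \<inter> (C - {p}))"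
      using E(1,2) open_delete_point[OF C(2)] by (auto intro: openin_Int)
    moreover have "?N - {p} \<subseteq> E \<inter> (C - {p}) \<union> E' \<inter> (C - {p})" using E(3) NC by blast
    moreover have "(E \<inter> (C - {p})) \<inter> (E' \<inter> (C - {p})) = {}" using E(4) by blast
    ultimately have "E \<inter> (C - {p}) \<inter> (?N - {p}) = {} \<or> E' \<inter> (C - {p}) \<inter> (?N - {p}) = {}"
      by (rule Nconn)
    then have "E \<inter> (?N - {p}) = {} \<or> E' \<inter> (?N - {p}) = {}" using NC by blast
    moreover have "C - {p} \<subseteq> E' \<union> E" "E' \<inter> E \<inter> (C - {p}) = {}" using E(3,4) by blast+
    ultimately show False using sep[OF E] sep[OF E(2,1) _ _ E(6,5)] by blast
  qed
  ultimately show ?thesis unfolding connectedin by blast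
qed (use C in simp)

lemma connectedin_delete_finite:
  assumes "finite F"
  shows "connectedin X (topspace X - F)" "openin X (topspace X - F)"
  using assms
proof (induction F)
  case empty
  show "connectedin X (topspace X - {})" using surface by (simp add: riemann_surface_def connectedin_topspace)
  show "openin X (topspace X - {})" by simp
next
  case (insert p F)
  have eq: "topspace X - insert p F = topspace X - F - {p}" by blast
  show "connectedin X (topspace X - insert p F)"
    unfolding eq by (rule connectedin_delete_point[OF insert.IH])
  show "openin X (topspace X - insert p F)"
    unfolding eq by (rule open_delete_point[OF insert.IH(2)])
qed

lemma riemann_surface_S: "riemann_surface (subtopology X S) (restrict_atlas S A)"
  unfolding riemann_surface_def
proof (intro conjI)
  show "topspace (subtopology X S) \<noteq> {}"
  proof
    assume "topspace (subtopology X S) = {}"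
    then have "topspace X \<subseteq> poles A z \<union> ramification_points X z" unfolding topspace_Y by (auto simp: S_def)
    then show False using finite_exceptional nonconstant finite_subset by blast
  qed
  show "Hausdorff_space (subtopology X S)" by (rule Hausdorff_space_subtopology[OF hausdorff_X])
  show "connected_space (subtopology X S)"
    using connectedin_delete_finite(1)[OF finite_exceptional] unfolding connectedin_def S_def by blast
  show "\<forall>c\<in>restrict_atlas S A. complex_chart (subtopology X S) c"
  proof
    fix c assume "c \<in> restrict_atlas S A"
    then obtain U \<phi> where U: "(U, \<phi>) \<in> A" and c: "c = (U \<inter> S, \<phi>)" by (auto simp: restrict_atlas_def)
    note ch = chart[OF U]
    have US: "openin X (U \<inter> S)" using complex_chart_domain_open[OF ch] open_S by (rule openin_Int)
    have hom: "homeomorphic_map (subtopology X U) (top_of_set (\<phi> ` U)) \<phi>"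
      using ch by (simp add: complex_chart_def)
    have "homeomorphic_map (subtopology (subtopology X U) (U \<inter> S)) (subtopology (top_of_set (\<phi> ` U)) (\<phi> ` (U \<inter> S))) \<phi>"
      using complex_chart_inj[OF ch] openin_subset[OF complex_chart_domain_open[OF ch]]
      by (intro homeomorphic_map_subtopologies[OF hom]) (auto dest: inj_onD)
    then have "homeomorphic_map (subtopology X (U \<inter> S)) (top_of_set (\<phi> ` (U \<inter> S))) \<phi>"
      by (simp add: subtopology_subtopology Int_absorb1 image_mono inf.absorb2)
    moreover have "open (\<phi> ` (U \<inter> S))" using complex_chart_open_image[OF ch US] by blast
    moreover have "openin (subtopology X S) (U \<inter> S)" using US open_S openin_open_subtopology by blast
    moreover have "subtopology (subtopology X S) (U \<inter> S) = subtopology X (U \<inter> S)"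
      by (simp add: subtopology_subtopology inf.absorb2)
    ultimately show "complex_chart (subtopology X S) c" by (simp add: complex_chart_def c)
  qed
  show "(\<Union>(U, \<phi>)\<in>restrict_atlas S A. U) = topspace (subtopology X S)"
    unfolding topspace_Y
  proof (intro equalityI subsetI)
    fix x assume "x \<in> S"
    moreover obtain U \<phi> where "(U, \<phi>) \<in> A" "x \<in> U" using chart_at S_subset \<open>x \<in> S\<close> by blast
    ultimately show "x \<in> (\<Union>(U, \<phi>)\<in>restrict_atlas S A. U)" by (force simp: restrict_atlas_def)
  qed (auto simp: restrict_atlas_def)
  show "\<forall>(U, \<phi>)\<in>restrict_atlas S A. \<forall>(V, \<psi>)\<in>restrict_atlas S A. (\<psi> \<circ> inv_into U \<phi>) holomorphic_on \<phi> ` (U \<inter> V)"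
  proof -
    have "(\<psi> \<circ> inv_into (U \<inter> S) \<phi>) holomorphic_on \<phi> ` ((U \<inter> S) \<inter> (V \<inter> S))"
      if UV: "(U, \<phi>) \<in> A" "(V, \<psi>) \<in> A" for U \<phi> V \<psi>
    proof -
      have "(\<psi> \<circ> inv_into U \<phi>) holomorphic_on \<phi> ` (U \<inter> V)"
        using surface UV unfolding riemann_surface_def by blast
      then have "(\<psi> \<circ> inv_into U \<phi>) holomorphic_on \<phi> ` ((U \<inter> S) \<inter> (V \<inter> S))"
        by (rule holomorphic_on_subset) auto
      moreover have "inv_into (U \<inter> S) \<phi> (\<phi> q) = inv_into U \<phi> (\<phi> q)" if "q \<in> U \<inter> S" for q
        using complex_chart_inj[OF chart[OF UV(1)]] that by (simp add: inj_on_Int)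
      ultimately show ?thesis by (subst holomorphic_cong[OF refl, where g = "\<psi> \<circ> inv_into U \<phi>"]) auto
    qed
    then show ?thesis unfolding restrict_atlas_def by auto
  qed
qed

lemma continuous_on_S: "continuous_map (subtopology X S) euclidean z"
proof (rule continuous_map_openin_preimage_eq[THEN iffD2], intro conjI allI impI)
  fix V :: "complex set" assume "openin euclidean V"
  then have V: "open V" by simp
  have "openin X {x \<in> S. z x \<in> V}"
  proof (subst openin_subopen, intro ballI)
    fix x assume x: "x \<in> {x \<in> S. z x \<in> V}"
    then have x': "x \<in> topspace X" "x \<notin> poles A z" by (auto simp: S_def)
    then obtain U \<phi> where U: "(U, \<phi>) \<in> A" "x \<in> U" using chart_at by blast
    obtain N where "openin X N" "x \<in> N" "z ` N \<subseteq> V"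
      by (rule continuous_nhd[OF U not_pole_analytic[OF U x'(2)] V]) (use x in auto)
    then have "openin X (N \<inter> S)" "x \<in> N \<inter> S" "N \<inter> S \<subseteq> {x \<in> S. z x \<in> V}"
      using x open_S by blast+
    then show "\<exists>T. openin X T \<and> x \<in> T \<and> T \<subseteq> {x \<in> S. z x \<in> V}" by blast
  qed
  then have "openin (subtopology X S) {x \<in> S. z x \<in> V}"
    by (subst openin_open_subtopology[OF open_S]) auto
  moreover have "topspace (subtopology X S) \<inter> z -` V = {x \<in> S. z x \<in> V}"
    unfolding topspace_Y by blast
  ultimately show "openin (subtopology X S) (topspace (subtopology X S) \<inter> z -` V)" by simp
qed simp

text \<open>The holomorphic inverse function theorem for \<open>z\<close> at a point of \<open>S\<close>.\<close>

lemma biholomorphic_nhd: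
  assumes U: "(U, \<phi>) \<in> A" "x \<in> U" and x: "x \<in> S"
  obtains V g where "open V" "\<phi> x \<in> V" "V \<subseteq> \<phi> ` (U \<inter> S)" "open ((z \<circ> inv_into U \<phi>) ` V)"
    "g holomorphic_on (z \<circ> inv_into U \<phi>) ` V" "\<forall>y\<in>V. g (z (inv_into U \<phi> y)) = y"
proof -
  let ?F = "z \<circ> inv_into U \<phi>"
  note ch = chart[OF U(1)]
  have "x \<notin> poles A z" using x by (auto simp: S_def)
  then obtain e where e: "e > 0" "ball (\<phi> x) e \<subseteq> \<phi> ` U" "?F holomorphic_on ball (\<phi> x) e"
    using analytic_nhd[OF U not_pole_analytic[OF U]] by blast
  obtain N where N: "openin X N" "x \<in> N" "inj_on z N"
    using x unfolding S_def ramification_points_def by blast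
  have "openin X (N \<inter> (U \<inter> S))" using N(1) complex_chart_domain_open[OF ch] open_S by blast
  then have opn: "open (\<phi> ` (N \<inter> (U \<inter> S)))" by (rule complex_chart_open_image[OF ch]) blast
  define V where "V = ball (\<phi> x) e \<inter> \<phi> ` (N \<inter> (U \<inter> S))"
  have V: "open V" "\<phi> x \<in> V" "V \<subseteq> \<phi> ` (U \<inter> S)" using opn e(1) N(2) U(2) x by (auto simp: V_def)
  have holo: "?F holomorphic_on V" using e(3) by (rule holomorphic_on_subset) (auto simp: V_def)
  have inj: "inj_on ?F V"
  proof (rule inj_onI)
    fix y y' assume y: "y \<in> V" "y' \<in> V" "?F y = ?F y'"
    then obtain q q' where q: "q \<in> N" "q \<in> U" "y = \<phi> q" "q' \<in> N" "q' \<in> U" "y' = \<phi> q'" by (auto simp: V_def)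
    then have "z q = z q'" using y(3) in_chart_image[OF U(1)] by simp
    then have "q = q'" using inj_onD[OF N(3)] q by blast
    then show "y = y'" using q by simp
  qed
  obtain g where g: "g holomorphic_on (?F ` V)" "\<And>y. y \<in> V \<Longrightarrow> g (?F y) = y"
    using holomorphic_has_inverse[OF holo V(1) inj] by metis
  show ?thesis
    by (rule that[OF V open_mapping_thm3[OF holo V(1) inj] g(1)]) (use g(2) in auto)
qed

lemma section_preimage_open:
  assumes "section_on (subtopology X S) z D s" "open D" "openin X W"
  shows "open {\<zeta> \<in> D. s \<zeta> \<in> W}"
proof -
  have "openin (subtopology X S) (S \<inter> W)" using assms(3) by (rule openin_subtopology_Int2)
  then have "openin (top_of_set D) {\<zeta> \<in> topspace (top_of_set D). s \<zeta> \<in> S \<inter> W}"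
    by (rule openin_continuous_map_preimage[OF section_onD(1)[OF assms(1)]])
  moreover have "{\<zeta> \<in> topspace (top_of_set D). s \<zeta> \<in> S \<inter> W} = {\<zeta> \<in> D. s \<zeta> \<in> W}"
    using section_onD(3)[OF assms(1)] topspace_Y by auto
  ultimately show ?thesis using openin_open_eq[OF assms(2)] by metis
qed

text \<open>Sections are automatically holomorphic: in a chart they coincide locally with the holomorphic
inverse of \<open>z\<close>.\<close>

lemma section_holomorphic:
  assumes s: "section_on (subtopology X S) z D s" and D: "open D" and U: "(U, \<phi>) \<in> A"
  shows "(\<phi> \<circ> s) holomorphic_on (D \<inter> s -` U)"
proof -
  have "\<exists>T. open T \<and> \<zeta> \<in> T \<and> T \<subseteq> D \<inter> s -` U \<and> (\<phi> \<circ> s) holomorphic_on T" if \<zeta>: "\<zeta> \<in> D \<inter> s -` U" for \<zeta>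
  proof -
    have sS: "s \<zeta> \<in> S" "s \<zeta> \<in> U" using section_onD(3)[OF s] \<zeta> topspace_Y by auto
    obtain V g where V: "open V" "\<phi> (s \<zeta>) \<in> V" "V \<subseteq> \<phi> ` (U \<inter> S)"
        "g holomorphic_on (z \<circ> inv_into U \<phi>) ` V" "\<forall>y\<in>V. g (z (inv_into U \<phi> y)) = y"
      using biholomorphic_nhd[OF U sS(2,1)] by metis
    let ?T = "{\<xi> \<in> D. s \<xi> \<in> {q \<in> U. \<phi> q \<in> V}}"
    have T: "open ?T"
      by (rule section_preimage_open[OF s D complex_chart_open_preimage[OF chart[OF U] V(1)]])
    have eq: "z (inv_into U \<phi> (\<phi> (s \<xi>))) = \<xi>" if "\<xi> \<in> ?T" for \<xi>
      using that in_chart_image[OF U, of "s \<xi>"] section_onD(2)[OF s, of \<xi>] by simp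
    have "?T \<subseteq> (z \<circ> inv_into U \<phi>) ` V"
    proof
      fix \<xi> assume \<xi>: "\<xi> \<in> ?T"
      show "\<xi> \<in> (z \<circ> inv_into U \<phi>) ` V"
        by (rule image_eqI[of _ _ "\<phi> (s \<xi>)"]) (use eq[OF \<xi>] \<xi> in auto)
    qed
    then have "g holomorphic_on ?T" by (rule holomorphic_on_subset[OF V(4)])
    moreover have "g \<xi> = (\<phi> \<circ> s) \<xi>" if "\<xi> \<in> ?T" for \<xi>
      using eq[OF that] V(5) that by (metis (mono_tags, lifting) comp_apply mem_Collect_eq)
    ultimately have "(\<phi> \<circ> s) holomorphic_on ?T" using holomorphic_cong[OF refl] by (metis (no_types, lifting))
    moreover have "\<zeta> \<in> ?T" using \<zeta> V(2) by auto
    moreover have "?T \<subseteq> D \<inter> s -` U" by auto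
    ultimately show ?thesis using T by blast
  qed
  then obtain T where T: "\<And>\<zeta>. \<zeta> \<in> D \<inter> s -` U \<Longrightarrow> open (T \<zeta>) \<and> \<zeta> \<in> T \<zeta> \<and> T \<zeta> \<subseteq> D \<inter> s -` U \<and> (\<phi> \<circ> s) holomorphic_on T \<zeta>"
    by metis
  then have "(\<phi> \<circ> s) holomorphic_on (\<Union>\<zeta>\<in>D \<inter> s -` U. T \<zeta>)"
    by (intro holomorphic_on_UN_open) auto
  moreover have "D \<inter> s -` U \<subseteq> (\<Union>\<zeta>\<in>D \<inter> s -` U. T \<zeta>)" using T by blast
  ultimately show ?thesis using holomorphic_on_subset by blast
qed

lemma section_image_open:
  assumes s: "section_on (subtopology X S) z D s" and D: "open D"
  shows "openin X (s ` D)"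
proof (subst openin_subopen, intro ballI)
  fix x assume "x \<in> s ` D"
  then obtain \<zeta> where \<zeta>: "\<zeta> \<in> D" "x = s \<zeta>" by blast
  then have xS: "x \<in> S" using section_onD(3)[OF s] topspace_Y by auto
  then obtain N where N: "openin X N" "x \<in> N" "inj_on z N" unfolding S_def ramification_points_def by blast
  have "open {\<xi> \<in> D. s \<xi> \<in> N}" by (rule section_preimage_open[OF s D N(1)])
  then have "openin (subtopology X S) {q \<in> topspace (subtopology X S). z q \<in> {\<xi> \<in> D. s \<xi> \<in> N}}"
    by (intro openin_continuous_map_preimage[OF continuous_on_S]) simp
  then have "openin X {q \<in> S. z q \<in> {\<xi> \<in> D. s \<xi> \<in> N}}"
    unfolding topspace_Y using openin_open_subtopology[OF open_S] by blast
  then have "openin X (N \<inter> {q \<in> S. z q \<in> {\<xi> \<in> D. s \<xi> \<in> N}})" by (rule openin_Int[OF N(1)])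
  moreover have "x \<in> N \<inter> {q \<in> S. z q \<in> {\<xi> \<in> D. s \<xi> \<in> N}}"
    using N(2) xS \<zeta> section_onD(2)[OF s \<zeta>(1)] by auto
  moreover have "N \<inter> {q \<in> S. z q \<in> {\<xi> \<in> D. s \<xi> \<in> N}} \<subseteq> s ` D"
  proof
    fix q assume q: "q \<in> N \<inter> {q \<in> S. z q \<in> {\<xi> \<in> D. s \<xi> \<in> N}}"
    then have "z (s (z q)) = z q" using section_onD(2)[OF s, of "z q"] by auto
    then have "s (z q) = q" using inj_onD[OF N(3)] q by blast
    then show "q \<in> s ` D" using q by (metis (mono_tags, lifting) IntD2 image_eqI mem_Collect_eq)
  qed
  ultimately show "\<exists>T. openin X T \<and> x \<in> T \<and> T \<subseteq> s ` D" by blast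
qed

text \<open>The values of \<open>f\<close> are prescribed only on the image of the section so that the lemma
also covers \<open>inv_into D g\<close>, the inverse map that occurs in \<open>holomorphic_diffeo_into\<close>.\<close>

lemma section_biholomorphism:
  assumes s: "section_on (subtopology X S) z D s" and D: "open D" and f: "\<And>q. q \<in> s ` D \<Longrightarrow> f q = z q"
  shows "biholomorphism (subtopology X S) (restrict_atlas S A) (s ` D) f D"
  unfolding biholomorphism_def
proof (intro conjI)
  have fs: "f (s \<zeta>) = \<zeta>" if "\<zeta> \<in> D" for \<zeta> using f section_onD(2)[OF s that] that by simp
  have sS: "s ` D \<subseteq> S" using section_onD(3)[OF s] topspace_Y by auto
  show "openin (subtopology X S) (s ` D)"
    using section_image_open[OF s D] sS openin_open_subtopology[OF open_S] by blast
  show "open D" by (fact D)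
  show bij: "bij_betw f (s ` D) D"
    by (rule bij_betw_byWitness[of _ s]) (use fs in auto)
  have inv: "inv_into (s ` D) f \<zeta> = s \<zeta>" if "\<zeta> \<in> D" for \<zeta>
    using bij_betw_imp_inj_on[OF bij] fs[OF that] that by (metis image_eqI inv_into_f_f)
  show "holomorphic_fun_on (restrict_atlas S A) f (s ` D)"
    unfolding holomorphic_fun_on_def
  proof (rule ballI, clarify)
    fix U' \<phi> assume "(U', \<phi>) \<in> restrict_atlas S A"
    then obtain U where U: "(U, \<phi>) \<in> A" and U': "U' = U \<inter> S" by (auto simp: restrict_atlas_def)
    have "(z \<circ> inv_into U \<phi>) analytic_on {\<phi> q}" if "q \<in> U' \<inter> s ` D" for q
      using that U' by (intro not_pole_analytic[OF U]) (auto simp: S_def)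
    then have "(z \<circ> inv_into U \<phi>) analytic_on \<phi> ` (U' \<inter> s ` D)"
      using analytic_on_analytic_at by blast
    then have "(z \<circ> inv_into U \<phi>) holomorphic_on \<phi> ` (U' \<inter> s ` D)" by (rule analytic_imp_holomorphic)
    moreover have "(z \<circ> inv_into U \<phi>) y = (f \<circ> inv_into U' \<phi>) y" if "y \<in> \<phi> ` (U' \<inter> s ` D)" for y
    proof -
      obtain q where q: "q \<in> U'" "q \<in> s ` D" "y = \<phi> q" using \<open>y \<in> _\<close> by blast
      have "inj_on \<phi> U'" using complex_chart_inj[OF chart[OF U]] U' by (simp add: inj_on_Int)
      then have "inv_into U' \<phi> y = q" "inv_into U \<phi> y = q"
        using q U' in_chart_image[OF U, of q] by auto
      then show ?thesis using f[OF q(2)] by simp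
    qed
    ultimately show "(f \<circ> inv_into U' \<phi>) holomorphic_on \<phi> ` (U' \<inter> s ` D)"
      by (rule holomorphic_transform)
  qed
  show "holomorphic_into (subtopology X S) (restrict_atlas S A) (inv_into (s ` D) f) D"
    unfolding holomorphic_into_def
  proof (intro conjI, goal_cases)
    case 1
    show ?case by (rule continuous_map_eq[OF section_onD(1)[OF s]]) (simp add: inv)
  next
    case 2
    show ?case
    proof (rule ballI, clarify)
      fix U' \<phi> assume "(U', \<phi>) \<in> restrict_atlas S A"
      then obtain U where U: "(U, \<phi>) \<in> A" and U': "U' = U \<inter> S" by (auto simp: restrict_atlas_def)
      have eq: "D \<inter> inv_into (s ` D) f -` U' = D \<inter> s -` U" using sS U' by (auto simp: inv)
      show "(\<phi> \<circ> inv_into (s ` D) f) holomorphic_on D \<inter> inv_into (s ` D) f -` U'"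
        unfolding eq by (rule holomorphic_transform[OF section_holomorphic[OF s D U]]) (simp add: inv)
    qed
  qed
qed

lemma section_diffeo:
  assumes g: "section_on (subtopology X S) z D g" and D: "open D"
  shows "holomorphic_diffeo_into (subtopology X S) (restrict_atlas S A) g D"
proof -
  have inj: "inj_on g D" using section_onD(2)[OF g] by (metis inj_onI)
  have "inv_into D g q = z q" if "q \<in> g ` D" for q
    using that inj section_onD(2)[OF g] by auto
  then show ?thesis
    unfolding holomorphic_diffeo_into_def using inj section_biholomorphism[OF g D] by blast
qed

section \<open>Covering properties of the projection\<close>

text \<open>Properness of \<open>z\<close> off its poles: since \<open>X\<close> is compact, a point whose value is close to \<open>b\<close> is close to
the fibre over \<open>b\<close>. Near a pole, \<open>z\<close> is large and stays away from \<open>b\<close>.\<close>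

lemma fibre_neighbourhood:
  assumes V: "openin X V" "{q \<in> topspace X - poles A z. z q = b} \<subseteq> V"
  obtains r where "r > 0" "\<forall>q\<in>topspace X - poles A z. z q \<in> ball b r \<longrightarrow> q \<in> V"
proof -
  define good where "good N \<longleftrightarrow> (\<exists>r>0. \<forall>q\<in>N - poles A z. z q \<in> ball b r \<longrightarrow> q \<in> V)" for N
  have nhd: "\<exists>N. openin X N \<and> x \<in> N \<and> good N" if x: "x \<in> topspace X" for x
  proof (cases "x \<in> V")
    case True
    then show ?thesis using V(1) unfolding good_def by (intro exI[of _ V]) (auto intro: exI[of _ 1])
  next
    case False
    show ?thesis
    proof (cases "x \<in> poles A z")
      case True
      then obtain N where N: "openin X N" "x \<in> N" "\<forall>q\<in>N - {x}. norm b + 1 < norm (z q)"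
        by (rule pole_nhd)
      have "z q \<notin> ball b 1" if "q \<in> N - poles A z" for q
      proof -
        have "norm b + 1 < norm (z q)" using N(3) that True by blast
        then show ?thesis using norm_triangle_ineq[of "z q - b" b] by (simp add: dist_norm norm_minus_commute)
      qed
      then have "good N" unfolding good_def by (intro exI[of _ 1]) simp
      then show ?thesis using N by blast
    next
      case np: False
      obtain U \<phi> where U: "(U, \<phi>) \<in> A" "x \<in> U" using chart_at x by blast
      define r where "r = dist b (z x) / 2"
      have "z x \<noteq> b" using False np x V(2) by blast
      then have r: "r > 0" by (simp add: r_def)
      obtain N where N: "openin X N" "x \<in> N" "z ` N \<subseteq> ball (z x) r"
        by (rule continuous_nhd[OF U not_pole_analytic[OF U np] open_ball[of "z x" r]]) (use r in auto)
      have "z q \<notin> ball b r" if "q \<in> N" for q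
      proof -
        have "dist (z x) (z q) < r" using N(3) that by auto
        then show ?thesis using dist_triangle[of b "z x" "z q"] by (simp add: r_def dist_commute)
      qed
      then have "good N" unfolding good_def using r by blast
      then show ?thesis using N by blast
    qed
  qed
  have "topspace X \<subseteq> \<Union>{N. openin X N \<and> good N}"
  proof
    fix x assume "x \<in> topspace X"
    then obtain N where "openin X N \<and> x \<in> N \<and> good N" using nhd by blast
    then show "x \<in> \<Union>{N. openin X N \<and> good N}" by blast
  qed
  moreover have "compactin X (topspace X)" using compact by (simp add: compact_space_def)
  moreover have "\<And>N. N \<in> {N. openin X N \<and> good N} \<Longrightarrow> openin X N" by simp
  ultimately obtain \<F> where \<F>: "finite \<F>" "\<F> \<subseteq> {N. openin X N \<and> good N}" "topspace X \<subseteq> \<Union>\<F>"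
    using compactinD[of X "topspace X" "{N. openin X N \<and> good N}"] by metis
  have "good (\<Union>\<F>)"
    using \<F>(1,2)
  proof (induction \<F>)
    case empty
    show ?case unfolding good_def by (intro exI[of _ 1]) simp
  next
    case (insert N \<F>)
    then have "good N" "good (\<Union>\<F>)" by simp_all
    then obtain r r' where r: "r > 0" "\<forall>q\<in>N - poles A z. z q \<in> ball b r \<longrightarrow> q \<in> V"
        "r' > 0" "\<forall>q\<in>\<Union>\<F> - poles A z. z q \<in> ball b r' \<longrightarrow> q \<in> V"
      unfolding good_def by meson
    have "q \<in> V" if "q \<in> \<Union>(insert N \<F>) - poles A z" "z q \<in> ball b (min r r')" for q
      using r(2,4) that by auto
    then show ?case unfolding good_def using r(1,3) by (intro exI[of _ "min r r'"]) simp
  qed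
  then obtain r where r: "r > 0" "\<forall>q\<in>\<Union>\<F> - poles A z. z q \<in> ball b r \<longrightarrow> q \<in> V"
    unfolding good_def by meson
  have "\<forall>q\<in>topspace X - poles A z. z q \<in> ball b r \<longrightarrow> q \<in> V"
  proof (intro ballI impI)
    fix q assume q: "q \<in> topspace X - poles A z" "z q \<in> ball b r"
    then have "q \<in> \<Union>\<F> - poles A z" using \<F>(3) by blast
    from r(2)[rule_format, OF this q(2)] show "q \<in> V" .
  qed
  with r(1) show ?thesis by (rule that)
qed

lemma local_section_S:
  assumes x: "x \<in> S"
  shows "\<exists>r>0. \<exists>s. section_on (subtopology X S) z (ball (z x) r) s \<and> s (z x) = x"
proof -
  obtain U \<phi> where U: "(U, \<phi>) \<in> A" "x \<in> U" using chart_at x S_subset by blast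
  let ?F = "z \<circ> inv_into U \<phi>"
  obtain V g where V: "open V" "\<phi> x \<in> V" "V \<subseteq> \<phi> ` (U \<inter> S)" "open (?F ` V)"
      "g holomorphic_on ?F ` V" and g: "\<forall>y\<in>V. g (z (inv_into U \<phi> y)) = y"
    by (rule biholomorphic_nhd[OF U x])
  have Fx: "?F (\<phi> x) = z x" using in_chart_image[OF U] by simp
  then have "z x \<in> ?F ` V" using V(2) by (metis image_eqI)
  then obtain r where r: "r > 0" "ball (z x) r \<subseteq> ?F ` V" using V(4) by (meson openE)
  have gV: "g \<zeta> \<in> V" "z (inv_into U \<phi> (g \<zeta>)) = \<zeta>" if "\<zeta> \<in> ball (z x) r" for \<zeta>
  proof -
    obtain y where "y \<in> V" "\<zeta> = ?F y" using r(2) \<open>\<zeta> \<in> _\<close> by blast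
    then show "g \<zeta> \<in> V" "z (inv_into U \<phi> (g \<zeta>)) = \<zeta>" using g by auto
  qed
  let ?s = "inv_into U \<phi> \<circ> g"
  have "continuous_on (ball (z x) r) g"
    using holomorphic_on_imp_continuous_on[OF V(5)] r(2) continuous_on_subset by blast
  moreover have "g \<in> ball (z x) r \<rightarrow> \<phi> ` U" using gV(1) V(3) by blast
  ultimately have "continuous_map (top_of_set (ball (z x) r)) (top_of_set (\<phi> ` U)) g"
    by (simp add: continuous_map_in_subtopology)
  then have "continuous_map (top_of_set (ball (z x) r)) X ?s"
    by (rule continuous_map_compose[OF _ complex_chart_inverse_continuous[OF chart[OF U(1)]]])
  moreover have "?s \<zeta> \<in> S" if "\<zeta> \<in> ball (z x) r" for \<zeta>
  proof -
    have "g \<zeta> \<in> \<phi> ` (U \<inter> S)" using gV(1)[OF that] V(3) by blast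
    then obtain q where "q \<in> U" "q \<in> S" "g \<zeta> = \<phi> q" by blast
    then show ?thesis using in_chart_image[OF U(1), of q] by simp
  qed
  ultimately have "continuous_map (top_of_set (ball (z x) r)) (subtopology X S) ?s"
    by (auto simp: continuous_map_in_subtopology)
  then have "section_on (subtopology X S) z (ball (z x) r) ?s"
    unfolding section_on_def using gV(2) by simp
  moreover have "?s (z x) = x"
    using bspec[OF g V(2)] in_chart_image[OF U] by simp
  ultimately show ?thesis using r(1) by blast
qed

text \<open>Over a value \<open>c\<close> that is not attained at an exceptional point, the finite fibre lies in \<open>S\<close>, and each
of its points has a section on a disc; by properness these sections exhaust the points over a small disc.\<close>

lemma evenly_covered_S:
  assumes c: "c \<notin> z ` (poles A z \<union> ramification_points X z)"
  shows "\<exists>r>0. \<forall>x\<in>S. z x \<in> ball c r \<longrightarrow>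
    (\<exists>s. section_on (subtopology X S) z (ball c r) s \<and> s (z x) = x)"
proof -
  define Q where "Q = {q \<in> topspace X - poles A z. z q = c}"
  have QS: "q \<in> S" "z q = c" if "q \<in> Q" for q using that c by (auto simp: Q_def S_def)
  have "finite Q" by (rule finite_subset[OF _ finite_fibre[of c]]) (auto simp: Q_def)
  have "\<forall>q\<in>Q. \<exists>r. r > 0 \<and> (\<exists>s. section_on (subtopology X S) z (ball c r) s \<and> s c = q)"
    using local_section_S QS by metis
  then obtain \<rho> s where \<rho>: "\<And>q. q \<in> Q \<Longrightarrow> \<rho> q > 0"
      and s: "\<And>q. q \<in> Q \<Longrightarrow> section_on (subtopology X S) z (ball c (\<rho> q)) (s q)"
      and sc: "\<And>q. q \<in> Q \<Longrightarrow> s q c = q"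
    by metis
  define r0 where "r0 = Min (insert 1 (\<rho> ` Q))"
  have r0: "r0 > 0" "\<And>q. q \<in> Q \<Longrightarrow> r0 \<le> \<rho> q"
    using \<open>finite Q\<close> \<rho> by (auto simp: r0_def)
  have s0: "section_on (subtopology X S) z (ball c r0) (s q)" if "q \<in> Q" for q
    by (rule section_on_subset[OF s[OF that] subset_ball[OF r0(2)[OF that]]])
  let ?V = "\<Union>q\<in>Q. s q ` ball c r0"
  have "openin X ?V" using section_image_open[OF s0 open_ball] by (intro openin_Union) auto
  moreover have "{q \<in> topspace X - poles A z. z q = c} \<subseteq> ?V"
  proof
    fix q assume "q \<in> {q \<in> topspace X - poles A z. z q = c}"
    then have "q \<in> Q" by (simp add: Q_def)
    then show "q \<in> ?V" using sc[of q] r0(1) by (metis UN_I centre_in_ball image_eqI)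
  qed
  ultimately obtain r1 where r1: "r1 > 0" "\<forall>q\<in>topspace X - poles A z. z q \<in> ball c r1 \<longrightarrow> q \<in> ?V"
    by (rule fibre_neighbourhood)
  define r where "r = min r0 r1"
  have "\<exists>t. section_on (subtopology X S) z (ball c r) t \<and> t (z x) = x" if x: "x \<in> S" "z x \<in> ball c r" for x
  proof -
    have "x \<in> topspace X - poles A z" "z x \<in> ball c r1" using x by (auto simp: S_def r_def)
    then have "x \<in> ?V" using r1(2) by blast
    then obtain q \<zeta> where q: "q \<in> Q" "\<zeta> \<in> ball c r0" "x = s q \<zeta>" by blast
    then have "s q (z x) = x" using section_onD(2)[OF s0[OF q(1)] q(2)] by simp
    moreover have "section_on (subtopology X S) z (ball c r) (s q)"
      by (rule section_on_subset[OF s0[OF q(1)]]) (auto simp: r_def)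
    ultimately show ?thesis by blast
  qed
  then show ?thesis using r0(1) r1(1) by (intro exI[of _ r]) (auto simp: r_def)
qed

text \<open>As \<open>\<zeta>\<close> tends to \<open>b\<close>, the values of the section accumulate only at the finite fibre over \<open>b\<close>. A
punctured disc is connected, so for each point of the fibre the section either converges to it or eventually avoids
a neighbourhood of it, and it cannot avoid them all.\<close>

lemma section_limit_exists:
  assumes s: "section_on (subtopology X S) z (ball b r - {b}) s" and r: "r > 0"
  obtains q where "q \<in> topspace X - poles A z" "z q = b" "limitin X s q (at b)"
proof -
  define Q where "Q = {q \<in> topspace X - poles A z. z q = b}"
  have "finite Q" by (rule finite_subset[OF _ finite_fibre[of b]]) (auto simp: Q_def)
  have QX: "Q \<subseteq> topspace X" by (auto simp: Q_def)
  have near: "eventually (\<lambda>\<zeta>. s \<zeta> \<in> V) (at b)" if V: "openin X V" "Q \<subseteq> V" for V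
  proof -
    obtain r' where r': "r' > 0" "\<forall>q\<in>topspace X - poles A z. z q \<in> ball b r' \<longrightarrow> q \<in> V"
      using fibre_neighbourhood[OF V(1)] V(2) unfolding Q_def by blast
    have "s \<zeta> \<in> V" if "\<zeta> \<in> ball b (min r r') - {b}" for \<zeta>
    proof -
      have "\<zeta> \<in> ball b r - {b}" using that by simp
      then have "s \<zeta> \<in> topspace X - poles A z" "z (s \<zeta>) = \<zeta>"
        using section_onD(2,3)[OF s, of \<zeta>] topspace_Y by (auto simp: S_def)
      then show ?thesis using r'(2) that by auto
    qed
    then show ?thesis
      unfolding eventually_at_topological using r r'(1)
      by (intro exI[of _ "ball b (min r r')"]) auto
  qed
  have dichotomy: "limitin X s q (at b) \<or> (\<exists>N. openin X N \<and> q \<in> N \<and> eventually (\<lambda>\<zeta>. s \<zeta> \<notin> N) (at b))"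
    if q: "q \<in> Q" for q
  proof (cases "limitin X s q (at b)")
    case False
    then obtain N0 where N0: "openin X N0" "q \<in> N0" "\<not> eventually (\<lambda>\<zeta>. s \<zeta> \<in> N0) (at b)"
      using q QX unfolding limitin_def by blast
    have "compactin X {q}" "compactin X (Q - {q})" "disjnt {q} (Q - {q})"
      using q QX \<open>finite Q\<close> by (auto intro!: finite_imp_compactin simp: disjnt_def)
    then obtain U1 U2 where U12: "openin X U1" "openin X U2" "{q} \<subseteq> U1" "Q - {q} \<subseteq> U2" "disjnt U1 U2"
      using hausdorff_X unfolding Hausdorff_space_compact_sets by meson
    have "openin X (U1 \<inter> N0 \<union> U2)" "Q \<subseteq> U1 \<inter> N0 \<union> U2" using U12 N0 by auto
    then have "eventually (\<lambda>\<zeta>. s \<zeta> \<in> U1 \<inter> N0 \<union> U2) (at b)" by (rule near)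
    then obtain T where T: "open T" "b \<in> T" "\<forall>\<zeta>\<in>T. \<zeta> \<noteq> b \<longrightarrow> s \<zeta> \<in> U1 \<inter> N0 \<union> U2"
      unfolding eventually_at_topological by blast
    then have "open (T \<inter> ball b r)" "b \<in> T \<inter> ball b r" using r by auto
    then obtain \<epsilon> where \<epsilon>: "\<epsilon> > 0" "ball b \<epsilon> \<subseteq> T \<inter> ball b r" by (meson openE)
    let ?P = "ball b \<epsilon> - {b}"
    have P: "section_on (subtopology X S) z ?P s" by (rule section_on_subset[OF s]) (use \<epsilon>(2) in blast)
    have oP: "open ?P" by blast
    let ?P1 = "{\<zeta> \<in> ?P. s \<zeta> \<in> U1 \<inter> N0}" and ?P2 = "{\<zeta> \<in> ?P. s \<zeta> \<in> U2}"
    have "open ?P1" by (rule section_preimage_open[OF P oP openin_Int[OF U12(1) N0(1)]])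
    moreover have "open ?P2" by (rule section_preimage_open[OF P oP U12(2)])
    moreover have "?P1 \<inter> ?P2 \<inter> ?P = {}" using U12(5) by (auto simp: disjnt_def)
    moreover have P12: "?P \<subseteq> ?P1 \<union> ?P2"
    proof
      fix \<zeta> assume \<zeta>: "\<zeta> \<in> ?P"
      then have "\<zeta> \<in> T" "\<zeta> \<noteq> b" using \<epsilon>(2) by auto
      then have "s \<zeta> \<in> U1 \<inter> N0 \<union> U2" using T(3) by simp
      then show "\<zeta> \<in> ?P1 \<union> ?P2" using \<zeta> by simp
    qed
    moreover have "connected ?P" by (rule connected_punctured_ball) simp
    ultimately have "?P1 \<inter> ?P = {} \<or> ?P2 \<inter> ?P = {}" by (intro connectedD)
    moreover have "?P2 \<inter> ?P \<noteq> {}"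
    proof
      assume "?P2 \<inter> ?P = {}"
      then have "\<forall>\<zeta>\<in>ball b \<epsilon>. \<zeta> \<noteq> b \<longrightarrow> s \<zeta> \<in> N0" using P12 by auto
      then have "eventually (\<lambda>\<zeta>. s \<zeta> \<in> N0) (at b)"
        unfolding eventually_at_topological using \<epsilon>(1) by (intro exI[of _ "ball b \<epsilon>"]) auto
      then show False using N0(3) by blast
    qed
    ultimately have "?P1 \<inter> ?P = {}" by blast
    then have "\<forall>\<zeta>\<in>ball b \<epsilon>. \<zeta> \<noteq> b \<longrightarrow> s \<zeta> \<notin> U1 \<inter> N0" by auto
    then have "eventually (\<lambda>\<zeta>. s \<zeta> \<notin> U1 \<inter> N0) (at b)"
      unfolding eventually_at_topological using \<epsilon>(1) by (intro exI[of _ "ball b \<epsilon>"]) auto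
    moreover have "openin X (U1 \<inter> N0)" "q \<in> U1 \<inter> N0" using U12(1,3) N0(1,2) by auto
    ultimately show ?thesis by blast
  qed blast
  have "\<exists>q\<in>Q. limitin X s q (at b)"
  proof (rule ccontr)
    assume "\<not> (\<exists>q\<in>Q. limitin X s q (at b))"
    then obtain N where N: "\<And>q. q \<in> Q \<Longrightarrow> openin X (N q)" "\<And>q. q \<in> Q \<Longrightarrow> q \<in> N q"
        "\<And>q. q \<in> Q \<Longrightarrow> eventually (\<lambda>\<zeta>. s \<zeta> \<notin> N q) (at b)"
      using dichotomy by metis
    have "openin X (\<Union>q\<in>Q. N q)" "Q \<subseteq> (\<Union>q\<in>Q. N q)" using N(1,2) by auto
    then have "eventually (\<lambda>\<zeta>. s \<zeta> \<in> (\<Union>q\<in>Q. N q)) (at b)" by (rule near)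
    moreover have "eventually (\<lambda>\<zeta>. \<forall>q\<in>Q. s \<zeta> \<notin> N q) (at b)"
      using \<open>finite Q\<close> N(3) by (intro eventually_ball_finite) auto
    ultimately have "eventually (\<lambda>\<zeta>. False) (at b)" by eventually_elim blast
    then show False by simp
  qed
  then show ?thesis using that by (auto simp: Q_def)
qed

text \<open>Put the limit into the puncture. In a chart, the extended section is continuous, so the
singularity is removable; it is injective with left inverse \<open>z\<close>, so its image is an open set on which \<open>z\<close> is
injective. Hence the limit is no ramification point and belongs to \<open>S\<close>.\<close>

lemma section_extends_over_puncture:
  assumes s: "section_on (subtopology X S) z (ball b r - {b}) s" and r: "r > 0"
  shows "\<exists>s'. section_on (subtopology X S) z (ball b r) s' \<and> (\<forall>\<zeta>\<in>ball b r - {b}. s' \<zeta> = s \<zeta>)"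
proof -
  let ?P = "ball b r - {b}"
  have oP: "open ?P" by blast
  obtain q where q: "q \<in> topspace X" "q \<notin> poles A z" "z q = b" and lim: "limitin X s q (at b)"
    using section_limit_exists[OF s r] by blast
  define s' where "s' = s(b := q)"
  have pre: "open {\<zeta> \<in> ball b r. s' \<zeta> \<in> W}" if W: "openin X W" for W
  proof -
    have *: "open {\<zeta> \<in> ?P. s \<zeta> \<in> W}" by (rule section_preimage_open[OF s oP W])
    show ?thesis
    proof (cases "q \<in> W")
      case True
      then have "eventually (\<lambda>\<zeta>. s \<zeta> \<in> W) (at b)" using lim W unfolding limitin_def by blast
      then obtain T where T: "open T" "b \<in> T" "\<forall>\<zeta>\<in>T. \<zeta> \<noteq> b \<longrightarrow> s \<zeta> \<in> W"
        unfolding eventually_at_topological by blast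
      have "{\<zeta> \<in> ball b r. s' \<zeta> \<in> W} = {\<zeta> \<in> ?P. s \<zeta> \<in> W} \<union> (T \<inter> ball b r)"
        using T True by (auto simp: s'_def)
      then show ?thesis using * T(1) by (simp add: open_Int open_Un)
    next
      case False
      then have "{\<zeta> \<in> ball b r. s' \<zeta> \<in> W} = {\<zeta> \<in> ?P. s \<zeta> \<in> W}" by (auto simp: s'_def)
      then show ?thesis using * by simp
    qed
  qed
  have zs': "z (s' \<zeta>) = \<zeta>" if "\<zeta> \<in> ball b r" for \<zeta>
    using section_onD(2)[OF s, of \<zeta>] that q(3) by (auto simp: s'_def)
  obtain U \<phi> where U: "(U, \<phi>) \<in> A" "q \<in> U" using chart_at q(1) by blast
  let ?F = "z \<circ> inv_into U \<phi>"
  note ch = chart[OF U(1)]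
  have "open {\<zeta> \<in> ball b r. s' \<zeta> \<in> U}" by (rule pre[OF complex_chart_domain_open[OF ch]])
  moreover have "b \<in> {\<zeta> \<in> ball b r. s' \<zeta> \<in> U}" using r U(2) by (simp add: s'_def)
  ultimately obtain \<epsilon> where \<epsilon>: "\<epsilon> > 0" "ball b \<epsilon> \<subseteq> {\<zeta> \<in> ball b r. s' \<zeta> \<in> U}" by (meson openE)
  let ?G = "\<phi> \<circ> s'"
  have FG: "?F (?G \<zeta>) = \<zeta>" if "\<zeta> \<in> ball b \<epsilon>" for \<zeta>
  proof -
    have "s' \<zeta> \<in> U" "\<zeta> \<in> ball b r" using \<epsilon>(2) that by blast+
    then show ?thesis using in_chart_image[OF U(1)] zs' by simp
  qed
  have contG: "continuous_on (ball b \<epsilon>) ?G"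
  proof (subst continuous_on_open_vimage[OF open_ball], intro allI impI)
    fix V :: "complex set" assume V: "open V"
    have *: "open {\<zeta> \<in> ball b r. s' \<zeta> \<in> {x \<in> U. \<phi> x \<in> V}}" by (rule pre[OF complex_chart_open_preimage[OF ch V]])
    have "?G -` V \<inter> ball b \<epsilon> = {\<zeta> \<in> ball b r. s' \<zeta> \<in> {x \<in> U. \<phi> x \<in> V}} \<inter> ball b \<epsilon>"
    proof (intro equalityI subsetI)
      fix \<zeta> assume \<zeta>: "\<zeta> \<in> ?G -` V \<inter> ball b \<epsilon>"
      then have "\<zeta> \<in> ball b r" "s' \<zeta> \<in> U" using \<epsilon>(2) by blast+
      then show "\<zeta> \<in> {\<zeta> \<in> ball b r. s' \<zeta> \<in> {x \<in> U. \<phi> x \<in> V}} \<inter> ball b \<epsilon>" using \<zeta> by simp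
    qed simp
    then show "open (?G -` V \<inter> ball b \<epsilon>)" using open_Int[OF * open_ball] by simp
  qed
  have "(\<phi> \<circ> s) holomorphic_on ball b \<epsilon> - {b}"
  proof (rule holomorphic_on_subset[OF section_holomorphic[OF s oP U(1)]], rule subsetI)
    fix \<zeta> assume \<zeta>: "\<zeta> \<in> ball b \<epsilon> - {b}"
    then have "\<zeta> \<in> ball b r" "s' \<zeta> \<in> U" using \<epsilon>(2) by blast+
    then show "\<zeta> \<in> ?P \<inter> s -` U" using \<zeta> by (simp add: s'_def)
  qed
  then have "?G holomorphic_on ball b \<epsilon> - {b}"
    by (rule holomorphic_transform) (auto simp: s'_def)
  then have G: "?G holomorphic_on ball b \<epsilon>"
    using no_isolated_singularity[OF contG _ open_ball, of "{b}"] by blast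
  have "inj_on ?G (ball b \<epsilon>)" using FG by (metis inj_onI)
  then have "open (?G ` ball b \<epsilon>)" by (rule open_mapping_thm3[OF G open_ball])
  moreover have "\<phi> q \<in> ?G ` ball b \<epsilon>" using \<epsilon>(1) by (intro image_eqI[of _ _ b]) (auto simp: s'_def)
  moreover have "inj_on ?F (?G ` ball b \<epsilon>)" using FG by (intro inj_onI) auto
  ultimately have "q \<notin> ramification_points X z" by (rule not_ramified[OF U])
  then have "q \<in> S" using q by (simp add: S_def)
  then have s'S: "s' \<zeta> \<in> S" if "\<zeta> \<in> ball b r" for \<zeta>
    using section_onD(3)[OF s, of \<zeta>] that topspace_Y by (auto simp: s'_def)
  have "continuous_map (top_of_set (ball b r)) X s'"
  proof (rule continuous_map[THEN iffD2], intro conjI allI impI)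
    show "s' ` topspace (top_of_set (ball b r)) \<subseteq> topspace X" using s'S S_subset by auto
    fix W assume "openin X W"
    then have "open {\<zeta> \<in> ball b r. s' \<zeta> \<in> W}" by (rule pre)
    then show "openin (top_of_set (ball b r)) {x \<in> topspace (top_of_set (ball b r)). s' x \<in> W}"
      by (subst openin_open_eq[OF open_ball]) (simp add: subset_iff)
  qed
  then have "section_on (subtopology X S) z (ball b r) s'"
    unfolding section_on_def using s'S zs' by (auto simp: continuous_map_in_subtopology)
  then show ?thesis by (intro exI[of _ s']) (auto simp: s'_def)
qed

sublocale branched_projection "subtopology X S" z "z ` (poles A z \<union> ramification_points X z)"
proof
  show "Hausdorff_space (subtopology X S)" by (rule Hausdorff_space_subtopology[OF hausdorff_X])
  show "\<exists>N. openin (subtopology X S) N \<and> x \<in> N \<and> inj_on z N" if "x \<in> topspace (subtopology X S)" for x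
  proof -
    have x: "x \<in> S" using that topspace_Y by simp
    then obtain N where "openin X N" "x \<in> N" "inj_on z N" unfolding S_def ramification_points_def by blast
    then have "openin (subtopology X S) (S \<inter> N)" "x \<in> S \<inter> N" "inj_on z (S \<inter> N)"
      using x openin_subtopology_Int2 by (auto intro: inj_on_subset)
    then show ?thesis by blast
  qed
  show "finite (z ` (poles A z \<union> ramification_points X z))" using finite_exceptional by simp
qed (use evenly_covered_S local_section_S section_extends_over_puncture topspace_Y in auto)

lemma log_chart_through:
  assumes p: "p \<in> S"
  shows "\<exists>U. p \<in> U \<and> U \<subseteq> S \<and> log_chart (subtopology X S) (restrict_atlas S A) (U, z)"
proof -
  let ?Y = "subtopology X S" and ?A = "restrict_atlas S A"
  obtain K s where K: "cut_system K"
    and s: "section_on ?Y z (- \<Union>(straight_cut ` K)) s" "p \<in> s ` (- \<Union>(straight_cut ` K))"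
    and sides: "\<forall>(a, u)\<in>K. \<forall>c\<in>straight_cut (a, u) - {a}.
      \<exists>r>0. ball c r \<inter> \<Union>(straight_cut ` K) \<subseteq> straight_cut (a, u) \<and>
        (\<exists>g h. section_on ?Y z (ball c r) g \<and> section_on ?Y z (ball c r) h \<and>
          (\<forall>\<zeta>\<in>ball c r. Im ((\<zeta> - a) / u) > 0 \<longrightarrow> g \<zeta> = s \<zeta>) \<and>
          (\<forall>\<zeta>\<in>ball c r. Im ((\<zeta> - a) / u) < 0 \<longrightarrow> h \<zeta> = s \<zeta>) \<and>
          (\<exists>\<zeta>\<in>ball c r. g \<zeta> \<noteq> h \<zeta>))"
    using log_chart_section[of p] p topspace_Y by auto
  define D where "D = - \<Union>(straight_cut ` K)"
  note s = s[folded D_def]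
  have "closed (\<Union>(straight_cut ` K))"
    unfolding closed_closedin
  proof (rule closedin_locally_finite_Union)
    show "locally_finite_in euclidean (straight_cut ` K)" using K unfolding cut_system_def by blast
  qed (use closed_straight_cut in \<open>auto simp flip: closed_closedin\<close>)
  then have D: "open D" unfolding D_def by (rule open_Compl)
  have US: "s ` D \<subseteq> S" using section_onD(3)[OF s(1)] topspace_Y by auto
  have inv: "inv_into (s ` D) z \<zeta> = s \<zeta>" if "\<zeta> \<in> D" for \<zeta>
  proof -
    have "inj_on z (s ` D)" using section_onD(2)[OF s(1)] by (auto intro!: inj_onI)
    then show ?thesis using inv_into_f_f[of z "s ` D" "s \<zeta>"] section_onD(2)[OF s(1) that] that by simp
  qed
  have bih: "biholomorphism ?Y ?A (s ` D) z D" by (rule section_biholomorphism[OF s(1) D refl])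
  have "two_sided_extension ?Y ?A (s ` D, z) K k c" if k: "k \<in> K" and c: "c \<in> straight_cut k - {fst k}" for k c
  proof -
    obtain a u where au: "k = (a, u)" by fastforce
    then have "(a, u) \<in> K" "c \<in> straight_cut (a, u) - {a}" using k c by auto
    then obtain r g h where r: "r > 0" "ball c r \<inter> \<Union>(straight_cut ` K) \<subseteq> straight_cut (a, u)"
      and gh: "section_on ?Y z (ball c r) g" "section_on ?Y z (ball c r) h"
      and g: "\<forall>\<zeta>\<in>ball c r. Im ((\<zeta> - a) / u) > 0 \<longrightarrow> g \<zeta> = s \<zeta>"
      and h: "\<forall>\<zeta>\<in>ball c r. Im ((\<zeta> - a) / u) < 0 \<longrightarrow> h \<zeta> = s \<zeta>"
      and ne: "\<exists>\<zeta>\<in>ball c r. g \<zeta> \<noteq> h \<zeta>"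
      using sides by blast
    have off: "inv_into (s ` D) z \<zeta> = s \<zeta>" if "\<zeta> \<in> ball c r" "Im ((\<zeta> - a) / u) \<noteq> 0" for \<zeta>
    proof (rule inv)
      have "\<zeta> \<notin> straight_cut (a, u)" using Im_on_straight_cut that(2) by blast
      then show "\<zeta> \<in> D" using r(2) that(1) unfolding D_def by blast
    qed
    have "(\<forall>\<zeta>\<in>ball c r. Im ((\<zeta> - a) / u) > 0 \<longrightarrow> g \<zeta> = inv_into (s ` D) z \<zeta>)"
      "(\<forall>\<zeta>\<in>ball c r. Im ((\<zeta> - a) / u) < 0 \<longrightarrow> h \<zeta> = inv_into (s ` D) z \<zeta>)"
      using g h off by auto
    then show ?thesis
      unfolding two_sided_extension_def au prod.case
      using r section_diffeo[OF gh(1) open_ball] section_diffeo[OF gh(2) open_ball] ne by blast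
  qed
  then have "log_chart ?Y ?A (s ` D, z)"
    unfolding log_chart_def prod.case using K bih unfolding D_def by blast
  then show ?thesis using s(2) US by blast
qed

text \<open>All log-charts with chart map \<open>z\<close> together form the required atlas.\<close>

lemma log_structure:
  "\<exists>L. log_riemann_surface (subtopology X S) (restrict_atlas S A) L \<and> (\<forall>p\<in>S. log_projection L p = z p)"
proof -
  define L where "L = {(U, z) |U. U \<subseteq> S \<and> log_chart (subtopology X S) (restrict_atlas S A) (U, z)}"
  have cover: "\<exists>U. (U, z) \<in> L \<and> p \<in> U" if "p \<in> S" for p
    using log_chart_through[OF that] by (auto simp: L_def)
  have "log_riemann_surface (subtopology X S) (restrict_atlas S A) L"
    unfolding log_riemann_surface_def
  proof (intro conjI riemann_surface_S)
    show "\<forall>c\<in>L. log_chart (subtopology X S) (restrict_atlas S A) c" by (auto simp: L_def)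
    show "(\<Union>(U, \<phi>)\<in>L. U) = topspace (subtopology X S)"
      unfolding topspace_Y using cover by (fastforce simp: L_def)
    have "z (inv_into V z \<zeta>) = \<zeta>" if "\<zeta> \<in> z ` (U \<inter> V)" for U V \<zeta>
      using that by (intro f_inv_into_f) auto
    then show "\<forall>(U, \<phi>)\<in>L. \<forall>(V, \<psi>)\<in>L. \<forall>\<zeta> \<in> \<psi> ` (U \<inter> V). \<phi> (inv_into V \<psi> \<zeta>) = \<zeta>"
      unfolding L_def by blast
  qed
  moreover have "log_projection L p = z p" if "p \<in> S" for p
    unfolding log_projection_def
    by (rule the_equality) (use cover[OF that] in \<open>auto simp: L_def\<close>)
  ultimately show ?thesis by blast
qed

end

section \<open>Values of a coordinate on an irreducible curve\<close>

text \<open>Let \<open>D\<close> be a nonzero element of least degree in the ideal generated by \<open>P\<close> and its derivative.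
Pseudo-division of \<open>P\<close> by \<open>D\<close> leaves no remainder, so \<open>P\<close> divides \<open>D * q\<close> for the pseudo-quotient \<open>q\<close>. As \<open>P\<close> is prime and
\<open>D\<close> has smaller degree than \<open>P\<close>, the factor \<open>q\<close> is divisible by \<open>P\<close>, and comparing degrees makes \<open>D\<close> a constant in \<open>w\<close>.\<close>

lemma bezout_pderiv:
  fixes P :: "complex poly poly"
  assumes P: "irreducible P" "degree P > 0"
  obtains U V d where "d \<noteq> 0" "U * P + V * pderiv P = [:d:]"
proof -
  define I where "I D \<longleftrightarrow> D \<noteq> 0 \<and> (\<exists>U V. D = U * P + V * pderiv P)" for D
  have "pderiv P \<noteq> 0" using P(2) by (simp add: pderiv_eq_0_iff)
  then have I': "I (pderiv P)" unfolding I_def by (intro conjI exI[of _ 0] exI[of _ 1]) auto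
  then obtain D where D: "I D" "\<And>R. I R \<Longrightarrow> degree D \<le> degree R"
    using ex_has_least_nat[of I "pderiv P" degree] by blast
  have "degree D < degree P"
    using D(2)[OF I'] P(2) by (simp add: degree_pderiv)
  obtain U V where UV: "D = U * P + V * pderiv P" and D0: "D \<noteq> 0" using D(1) unfolding I_def by blast
  obtain q r where qr: "pseudo_divmod P D = (q, r)" by fastforce
  define c where "c = coeff D (degree D) ^ (Suc (degree P) - degree D)"
  have div: "smult c P = D * q + r" "r = 0 \<or> degree r < degree D"
    using pseudo_divmod[OF D0 qr] by (auto simp: c_def)
  have "c \<noteq> 0" using D0 by (simp add: c_def)
  have "r = 0"
  proof (rule ccontr)
    assume "r \<noteq> 0"
    have "r = smult c P - D * q" using div(1) by simp
    also have "\<dots> = ([:c:] - q * U) * P + (- q * V) * pderiv P"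
      unfolding UV by (simp add: algebra_simps)
    finally have "I r" using \<open>r \<noteq> 0\<close> unfolding I_def by blast
    then show False using D(2) div(2) \<open>r \<noteq> 0\<close> by fastforce
  qed
  then have eq: "smult c P = D * q" using div(1) by simp
  (* By Gauss, the polynomials in w over the polynomials in z have unique factorization. *)
  have "prime_elem P" using P(1) by (rule irreducible_imp_prime_elem)
  moreover have "P dvd D * q" by (metis eq dvd_refl dvd_smult)
  moreover have "\<not> P dvd D" using \<open>degree D < degree P\<close> D0 dvd_imp_degree_le by force
  ultimately obtain k where "q = P * k" using prime_elem_dvd_mult_iff by blast
  then have "P * ([:c:] - D * k) = 0" using eq by (simp add: algebra_simps)
  then have c: "[:c:] = D * k" using P(2) by auto
  then have "D * k \<noteq> 0" using \<open>c \<noteq> 0\<close> by (metis pCons_eq_0_iff)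
  then have "degree D = 0" using c degree_mult_eq[of D k] by (metis add_is_0 degree_pCons_0 mult_zero_left mult_zero_right)
  then obtain d where "D = [:d:]" by (rule degree_eq_zeroE)
  then show ?thesis using that UV D0 by simp
qed

lemma poly_wz_eq: "poly_wz P a b = poly (map_poly (\<lambda>p. poly p b) P) a"
  unfolding poly_wz_def by (induction P) (auto simp: map_poly_pCons algebra_simps)

text \<open>Over every \<open>b\<close> that is a zero neither of the leading coefficient of \<open>P\<close> nor of the polynomial \<open>d\<close> in
the Bezout relation, \<open>P\<close> has a root, and the root is simple.\<close>

lemma infinite_regular_curve_projection:
  fixes P :: "complex poly poly"
  assumes P: "irreducible P" "degree P > 0"
  shows "infinite (snd ` regular_curve_points P)"
proof -
  obtain U V d where d: "d \<noteq> 0" "U * P + V * pderiv P = [:d:]" using bezout_pderiv[OF P] .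
  have "P \<noteq> 0" using P(2) by auto
  have "b \<in> snd ` regular_curve_points P" if b: "poly (d * lead_coeff P) b \<noteq> 0" for b
  proof -
    have "degree (map_poly (\<lambda>p. poly p b) P) = degree P"
      using b by (intro map_poly_degree_eq) auto
    then obtain a where "poly (map_poly (\<lambda>p. poly p b) P) a = 0"
      using P(2) fundamental_theorem_of_algebra[of "map_poly (\<lambda>p. poly p b) P"] by (auto simp: constant_degree)
    then have root: "poly_wz P a b = 0" by (simp add: poly_wz_eq)
    have "poly_wz U a b * poly_wz P a b + poly_wz V a b * poly_wz (pderiv P) a b = poly d b"
      using arg_cong[OF d(2), of "\<lambda>Q. poly_wz Q a b"] by (simp add: poly_wz_def)
    then have "poly_wz (pderiv P) a b \<noteq> 0" using root b by auto
    then have "(a, b) \<in> regular_curve_points P" using root by (simp add: regular_curve_points_def)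
    then show ?thesis by force
  qed
  then have "- {b. poly (d * lead_coeff P) b = 0} \<subseteq> snd ` regular_curve_points P" by auto
  moreover have "finite {b. poly (d * lead_coeff P) b = 0}"
    using d(1) \<open>P \<noteq> 0\<close> by (intro poly_roots_finite) auto
  then have "infinite (- {b. poly (d * lead_coeff P) b = 0})"
    using infinite_UNIV_char_0[where 'a=complex] by (metis Compl_eq_Diff_UNIV finite_Diff2)
  ultimately show ?thesis using finite_subset by blast
qed

section \<open>The log-Riemann surface of an algebraic curve\<close>

theorem corollaryI2p3p31:
  fixes P :: "complex poly poly"
    and X :: "'a topology" and A :: "'a chart set"
    and w z :: "'a \<Rightarrow> complex"
    and S :: "'a set"
  assumes "irreducible P" and "degree P > 0"
    and "compact_riemann_surface_of_curve P X A w z"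
    and "S = topspace X - (poles A z \<union> ramification_points X z)"
  shows "finite (poles A z \<union> ramification_points X z) \<and>
    (\<exists>L. log_riemann_surface (subtopology X S) (restrict_atlas S A) L \<and>
         (\<forall>p\<in>S. log_projection L p = z p))"
proof -
  obtain E where E: "E \<subseteq> topspace X"
      "homeomorphic_map (subtopology X (topspace X - E)) (top_of_set (regular_curve_points P)) (\<lambda>p. (w p, z p))"
    using assms(3) unfolding compact_riemann_surface_of_curve_def by blast
  have "(\<lambda>p. (w p, z p)) ` (topspace X - E) = regular_curve_points P"
    using homeomorphic_imp_surjective_map[OF E(2)] by (simp add: inf.absorb2)
  then have "z ` (topspace X - E) = snd ` regular_curve_points P" by (force simp: image_iff)
  then have "infinite (z ` topspace X)"
    using infinite_regular_curve_projection[OF assms(1,2)] finite_subset[of "z ` (topspace X - E)" "z ` topspace X"]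
    by auto
  then interpret compact_surface_function X A z
    using assms(3) unfolding compact_riemann_surface_of_curve_def by unfold_locales auto
  show ?thesis using finite_exceptional log_structure unfolding assms(4) S_def by blast
qed

end
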